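(* Let $k$ be a field of characteristic $\neq 2$, let $\mathcal A=k[t,t^{-1},(1-t)^{-1}]\subset k(t)$, $t'=1-t^{-1}$, $t''=(1-t)^{-1}$, and $\mathfrak g=\mathfrak{sl}_2(k)\otimes_k\mathcal A$. Let $x=\begin{pmatrix}-1&2\\0&1\end{pmatrix}$, $y=\begin{pmatrix}-1&0\\-2&1\end{pmatrix}$, $z=\begin{pmatrix}1&0\\0&-1\end{pmatrix}$. Define: <ul> <li>$\varphi_{\mathfrak s}$: the linear map of $\mathfrak{sl}_2(k)$ with $x\mapsto y$, $y\mapsto z$, $z\mapsto x$; and $\varphi_{\mathcal A}$: the $k$-algebra endomorphism of $\mathcal A$ with $\varphi_{\mathcal A}(t)=t'$;</li> <li>$\tau_{\mathfrak s}$: the linear map of $\mathfrak{sl}_2(k)$ with $x\mapsto -x$, $y\mapsto -z$, $z\mapsto -y$; and $\tau_{\mathcal A}$: the $k$-algebra endomorphism of $\mathcal A$ with $\tau_{\mathcal A}(t)=1-t$;</li> <li>$\tau_1$: the $\mathcal A$-linear map of $\mathfrak g$ with $\tau_1(x\otimes 1)=-x\otimes 1$, $\tau_1(y\otimes 1)=-(z\otimes t'+x\otimes(t'-1))$, $\tau_1(z\otimes 1)=x\otimes t''+y\otimes(t''-1)$;</li> <li>$\tau_2$: the $\mathcal A$-linear map of $\mathfrak g$ with $\tau_2(x\otimes 1)=y\otimes t+z\otimes(t-1)$, $\tau_2(y\otimes 1)=-y\otimes 1$, $\tau_2(z\otimes 1)=-(x\otimes t''+y\otimes(t''-1))$.</li>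 </ul> Then $\varphi_{\mathfrak s}$ and $\tau_{\mathfrak s}$ are automorphisms of $\mathfrak{sl}_2(k)$ of orders $3$ and $2$, $\varphi_{\mathcal A}$ and $\tau_{\mathcal A}$ are automorphisms of the $k$-algebra $\mathcal A$ of orders $3$ and $2$, $\tau_1,\tau_2$ are automorphisms of $\mathfrak g$ as a Lie algebra over $\mathcal A$, and there is an injective group homomorphism $\rho:S_4\to\mathrm{Aut}_k(\mathfrak g)$ (where $S_4$ is the group of permutations of $\{0,1,2,3\}$) with $\rho((123))=\varphi_{\mathfrak s}\otimes\varphi_{\mathcal A}$, $\rho((12))=\tau_{\mathfrak s}\otimes\tau_{\mathcal A}$, $\rho((12)(30))=\tau_1$, $\rho((23)(10))=\tau_2$. (In particular $\rho((123))$ and $\rho((12))$ are $\mathcal A$-semilinear with associated automorphisms $\varphi_{\mathcal A}$, $\tau_{\mathcal A}$, i.e. $\rho((123))(ga)=\rho((123))(g)\varphi_{\mathcal A}(a)$ and similarly for $(12)$.) Moreover, for the homomorphism $\Psi:\mathfrak g_\boxtimes\to\mathfrak g$ described in the context, $\Psi(\sigma(X))=\rho(\sigma)(\Psi(X))$ for all $\sigma\in S_4$ and $X\in\mathfrak g_\boxtimes$.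
   Context: The Tetrahedron algebra $\mathfrak g_\boxtimes$ is the Lie algebra over $k$ with generators $X_{ij}$ ($i,j\in\{0,1,2,3\}$, $i\neq j$) subject to the relations $X_{ij}+X_{ji}=0$ for $i\ne j$; $[X_{ij},X_{jk}]=2(X_{ij}+X_{jk})$ for mutually distinct $i,j,k$; and $[X_{hi},[X_{hi},[X_{hi},X_{jk}]]]=4[X_{hi},X_{jk}]$ for mutually distinct $h,i,j,k$. The group $S_4$ acts on $\mathfrak g_\boxtimes$ by automorphisms via $\sigma(X_{ij})=X_{\sigma(i)\sigma(j)}$. $\Psi:\mathfrak g_\boxtimes\to\mathfrak g$ is the Lie algebra homomorphism determined by $\Psi(X_{12})=x\otimes1$, $\Psi(X_{23})=y\otimes 1$, $\Psi(X_{31})=z\otimes 1$, $\Psi(X_{03})=y\otimes t+z\otimes(t-1)$, $\Psi(X_{01})=z\otimes t'+x\otimes(t'-1)$, $\Psi(X_{02})=x\otimes t''+y\otimes(t''-1)$. Permutations are written in cycle notation, e.g. $(12)(30)$ swaps $1\leftrightarrow2$ and $3\leftrightarrow0$. *)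

theory Defs
  imports "HOL-Analysis.Finite_Cartesian_Product"
          "HOL-Computational_Algebra.Polynomial_Factorial"
          "HOL-Computational_Algebra.Fraction_Field"
          "HOL-Combinatorics.Permutations"
          "HOL-Combinatorics.Transposition"
begin

definition mat2 :: "'f \<Rightarrow> 'f \<Rightarrow> 'f \<Rightarrow> 'f \<Rightarrow> 'f ^ 2 ^ 2" where
  "mat2 a b c d = (\<chi> i j. if i = 1 then (if j = 1 then a else b) else (if j = 1 then c else d))"

definition smat :: "'f::times \<Rightarrow> 'f ^ 2 ^ 2 \<Rightarrow> 'f ^ 2 ^ 2" where
  "smat c M = (\<chi> i j. c * M $ i $ j)"

definition brk :: "'f::comm_ring_1 ^ 2 ^ 2 \<Rightarrow> 'f ^ 2 ^ 2 \<Rightarrow> 'f ^ 2 ^ 2" where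
  "brk M N = M ** N - N ** M"

definition trace0 :: "'f::comm_ring_1 ^ 2 ^ 2 \<Rightarrow> bool" where
  "trace0 M \<longleftrightarrow> M $ 1 $ 1 + M $ 2 $ 2 = 0"

definition xm :: "'f::comm_ring_1 ^ 2 ^ 2" where "xm = mat2 (-1) 2 0 1"
definition ym :: "'f::comm_ring_1 ^ 2 ^ 2" where "ym = mat2 (-1) 0 (-2) 1"
definition zm :: "'f::comm_ring_1 ^ 2 ^ 2" where "zm = mat2 1 0 0 (-1)"

text \<open>Coordinates of a traceless matrix M = cx M x + cy M y + cz M z
  (x,y,z is a basis of sl2 when 2 is invertible).\<close>
definition cx :: "'f::field ^ 2 ^ 2 \<Rightarrow> 'f" where "cx M = M $ 1 $ 2 / 2"
definition cy :: "'f::field ^ 2 ^ 2 \<Rightarrow> 'f" where "cy M = - (M $ 2 $ 1 / 2)"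
definition cz :: "'f::field ^ 2 ^ 2 \<Rightarrow> 'f" where "cz M = M $ 1 $ 1 + M $ 1 $ 2 / 2 - M $ 2 $ 1 / 2"

definition sl2 :: "('k::field ^ 2 ^ 2) set" where "sl2 = {M. trace0 M}"

definition lin3 :: "'f::field ^ 2 ^ 2 \<Rightarrow> 'f ^ 2 ^ 2 \<Rightarrow> 'f ^ 2 ^ 2 \<Rightarrow> 'f ^ 2 ^ 2 \<Rightarrow> 'f ^ 2 ^ 2" where
  "lin3 u v w M = smat (cx M) u + smat (cy M) v + smat (cz M) w"

type_synonym 'k rf = "'k poly fract"

definition emb :: "'k::field \<Rightarrow> 'k rf" where "emb c = to_fract [:c:]"

definition T :: "'k::field rf" where "T = to_fract [:0, 1:]"

definition t1 :: "'k::field rf" where "t1 = 1 - 1 / T"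
definition t2 :: "'k::field rf" where "t2 = 1 / (1 - T)"

text \<open>A = k[t, t^-1, (1-t)^-1]: the k-subalgebra of k(t) generated by t, 1/t, 1/(1-t).\<close>
definition Aset :: "'k::field rf set" where
  "Aset = {to_fract p / (T ^ a * (1 - T) ^ b) | p a b. True}"

definition subst_rf :: "'k::field rf \<Rightarrow> 'k rf \<Rightarrow> 'k rf" where
  "subst_rf s r = (SOME v. \<exists>p q. r = Fract p q \<and> q \<noteq> 0 \<and> poly (map_poly emb q) s \<noteq> 0 \<and>
      v = poly (map_poly emb p) s / poly (map_poly emb q) s)"

definition phiA :: "'k::field rf \<Rightarrow> 'k rf" where "phiA = subst_rf t1"
definition tauA :: "'k::field rf \<Rightarrow> 'k rf" where "tauA = subst_rf (1 - T)"

section \<open>g = sl2(k) tensor A, identified with traceless matrices with entries in A\<close>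

definition lift :: "'k::field ^ 2 ^ 2 \<Rightarrow> 'k rf ^ 2 ^ 2" where
  "lift M = (\<chi> i j. emb (M $ i $ j))"

text \<open>x tensor a corresponds to smat a (lift x).\<close>
definition gset :: "('k::field rf ^ 2 ^ 2) set" where
  "gset = {M. trace0 M \<and> (\<forall>i j. M $ i $ j \<in> Aset)}"

definition X :: "'k::field rf ^ 2 ^ 2" where "X = lift xm"
definition Y :: "'k::field rf ^ 2 ^ 2" where "Y = lift ym"
definition Z :: "'k::field rf ^ 2 ^ 2" where "Z = lift zm"

text \<open>Tensor product f tensor h of a k-linear map f of sl2(k) and a map h of A.\<close>
definition tens :: "('k::field ^ 2 ^ 2 \<Rightarrow> 'k ^ 2 ^ 2) \<Rightarrow> ('k rf \<Rightarrow> 'k rf) \<Rightarrow> 'k rf ^ 2 ^ 2 \<Rightarrow> 'k rf ^ 2 ^ 2" where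
  "tens f h M = smat (h (cx M)) (lift (f xm)) + smat (h (cy M)) (lift (f ym)) + smat (h (cz M)) (lift (f zm))"

definition phiS :: "'k::field ^ 2 ^ 2 \<Rightarrow> 'k ^ 2 ^ 2" where "phiS = lin3 ym zm xm"
definition tauS :: "'k::field ^ 2 ^ 2 \<Rightarrow> 'k ^ 2 ^ 2" where "tauS = lin3 (- xm) (- zm) (- ym)"

definition tau1 :: "'k::field rf ^ 2 ^ 2 \<Rightarrow> 'k rf ^ 2 ^ 2" where
  "tau1 = lin3 (- X) (- (smat t1 Z + smat (t1 - 1) X)) (smat t2 X + smat (t2 - 1) Y)"
definition tau2 :: "'k::field rf ^ 2 ^ 2 \<Rightarrow> 'k rf ^ 2 ^ 2" where
  "tau2 = lin3 (smat T Y + smat (T - 1) Z) (- Y) (- (smat t2 X + smat (t2 - 1) Y))"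

definition lie_aut :: "'f::field set \<Rightarrow> ('f ^ 2 ^ 2) set \<Rightarrow> ('f ^ 2 ^ 2 \<Rightarrow> 'f ^ 2 ^ 2) \<Rightarrow> bool" where
  "lie_aut K S f \<longleftrightarrow> bij_betw f S S \<and>
     (\<forall>c\<in>K. \<forall>M\<in>S. \<forall>N\<in>S. f (smat c M + N) = smat c (f M) + f N) \<and>
     (\<forall>M\<in>S. \<forall>N\<in>S. f (brk M N) = brk (f M) (f N))"

definition alg_aut_A :: "('k::field rf \<Rightarrow> 'k rf) \<Rightarrow> bool" where
  "alg_aut_A f \<longleftrightarrow> bij_betw f Aset Aset \<and>
     (\<forall>a\<in>Aset. \<forall>b\<in>Aset. f (a + b) = f a + f b \<and> f (a * b) = f a * f b) \<and>
     (\<forall>c. f (emb c) = emb c)"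

definition order_on :: "'a set \<Rightarrow> ('a \<Rightarrow> 'a) \<Rightarrow> nat \<Rightarrow> bool" where
  "order_on S f n \<longleftrightarrow> 0 < n \<and> (\<forall>s\<in>S. (f ^^ n) s = s) \<and>
     (\<forall>m. 0 < m \<and> m < n \<longrightarrow> (\<exists>s\<in>S. (f ^^ m) s \<noteq> s))"

definition S4 :: "(nat \<Rightarrow> nat) set" where "S4 = {\<sigma>. \<sigma> permutes {0, 1, 2, 3}}"

definition c123 :: "nat \<Rightarrow> nat" where
  "c123 i = (if i = 1 then 2 else if i = 2 then 3 else if i = 3 then 1 else i)"

definition lie_algebra :: "('k::field \<Rightarrow> 'l::ab_group_add \<Rightarrow> 'l) \<Rightarrow> ('l \<Rightarrow> 'l \<Rightarrow> 'l) \<Rightarrow> bool" where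
  "lie_algebra sc lb \<longleftrightarrow>
     (\<forall>a u v. sc a (u + v) = sc a u + sc a v) \<and>
     (\<forall>a b u. sc (a + b) u = sc a u + sc b u) \<and>
     (\<forall>a b u. sc (a * b) u = sc a (sc b u)) \<and>
     (\<forall>u. sc 1 u = u) \<and>
     (\<forall>u v w. lb (u + v) w = lb u w + lb v w) \<and>
     (\<forall>u v w. lb u (v + w) = lb u v + lb u w) \<and>
     (\<forall>a u v. lb (sc a u) v = sc a (lb u v)) \<and>
     (\<forall>a u v. lb u (sc a v) = sc a (lb u v)) \<and>
     (\<forall>u. lb u u = 0) \<and>
     (\<forall>u v w. lb u (lb v w) + lb v (lb w u) + lb w (lb u v) = 0)"

inductive_set lie_span :: "('k \<Rightarrow> 'l::ab_group_add \<Rightarrow> 'l) \<Rightarrow> ('l \<Rightarrow> 'l \<Rightarrow> 'l) \<Rightarrow> 'l set \<Rightarrow> 'l set"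
  for sc lb G where
    gen: "u \<in> G \<Longrightarrow> u \<in> lie_span sc lb G"
  | zero: "0 \<in> lie_span sc lb G"
  | add: "u \<in> lie_span sc lb G \<Longrightarrow> v \<in> lie_span sc lb G \<Longrightarrow> u + v \<in> lie_span sc lb G"
  | scale: "u \<in> lie_span sc lb G \<Longrightarrow> sc a u \<in> lie_span sc lb G"
  | brk: "u \<in> lie_span sc lb G \<Longrightarrow> v \<in> lie_span sc lb G \<Longrightarrow> lb u v \<in> lie_span sc lb G"

definition tetra_gen :: "('k::field \<Rightarrow> 'l::ab_group_add \<Rightarrow> 'l) \<Rightarrow> ('l \<Rightarrow> 'l \<Rightarrow> 'l) \<Rightarrow> (nat \<Rightarrow> nat \<Rightarrow> 'l) \<Rightarrow> bool" where
  "tetra_gen sc lb Xg \<longleftrightarrow> lie_algebra sc lb \<and>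
     (\<forall>i\<in>{0..3}. \<forall>j\<in>{0..3}. i \<noteq> j \<longrightarrow> Xg i j + Xg j i = 0) \<and>
     (\<forall>i\<in>{0..3}. \<forall>j\<in>{0..3}. \<forall>k\<in>{0..3}. distinct [i, j, k] \<longrightarrow>
        lb (Xg i j) (Xg j k) = sc 2 (Xg i j + Xg j k)) \<and>
     (\<forall>h\<in>{0..3}. \<forall>i\<in>{0..3}. \<forall>j\<in>{0..3}. \<forall>k\<in>{0..3}. distinct [h, i, j, k] \<longrightarrow>
        lb (Xg h i) (lb (Xg h i) (lb (Xg h i) (Xg j k))) = sc 4 (lb (Xg h i) (Xg j k))) \<and>
     lie_span sc lb {Xg i j | i j. i \<in> {0..3} \<and> j \<in> {0..3} \<and> i \<noteq> j} = UNIV"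

definition tetra_action :: "('k::field \<Rightarrow> 'l::ab_group_add \<Rightarrow> 'l) \<Rightarrow> ('l \<Rightarrow> 'l \<Rightarrow> 'l) \<Rightarrow> (nat \<Rightarrow> nat \<Rightarrow> 'l)
     \<Rightarrow> ((nat \<Rightarrow> nat) \<Rightarrow> 'l \<Rightarrow> 'l) \<Rightarrow> bool" where
  "tetra_action sc lb Xg act \<longleftrightarrow> (\<forall>\<sigma>\<in>S4. bij (act \<sigma>) \<and>
     (\<forall>a u v. act \<sigma> (sc a u + v) = sc a (act \<sigma> u) + act \<sigma> v) \<and>
     (\<forall>u v. act \<sigma> (lb u v) = lb (act \<sigma> u) (act \<sigma> v)) \<and>
     (\<forall>i\<in>{0..3}. \<forall>j\<in>{0..3}. i \<noteq> j \<longrightarrow> act \<sigma> (Xg i j) = Xg (\<sigma> i) (\<sigma> j)))"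

definition is_Psi :: "('k::field \<Rightarrow> 'l::ab_group_add \<Rightarrow> 'l) \<Rightarrow> ('l \<Rightarrow> 'l \<Rightarrow> 'l) \<Rightarrow> (nat \<Rightarrow> nat \<Rightarrow> 'l)
     \<Rightarrow> ('l \<Rightarrow> 'k rf ^ 2 ^ 2) \<Rightarrow> bool" where
  "is_Psi sc lb Xg Psi \<longleftrightarrow>
     (\<forall>a u v. Psi (sc a u + v) = smat (emb a) (Psi u) + Psi v) \<and>
     (\<forall>u v. Psi (lb u v) = brk (Psi u) (Psi v)) \<and>
     Psi (Xg 1 2) = X \<and> Psi (Xg 2 3) = Y \<and> Psi (Xg 3 1) = Z \<and>
     Psi (Xg 0 3) = smat T Y + smat (T - 1) Z \<and>
     Psi (Xg 0 1) = smat t1 Z + smat (t1 - 1) X \<and>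
     Psi (Xg 0 2) = smat t2 X + smat (t2 - 1) Y"

end

theory Submission
  imports Defs "HOL-Analysis.Cartesian_Space"
begin

text \<open>
  Put \<open>p\<^sub>1 = \<infinity>\<close>, \<open>p\<^sub>2 = 1\<close>, \<open>p\<^sub>3 = 0\<close>, \<open>p\<^sub>0 = 1/t\<close> on the projective line over \<open>k(t)\<close>. The image of
  \<open>X\<^sub>i\<^sub>j\<close> under \<open>\<Psi>\<close> is the traceless matrix \<open>E\<^sub>i\<^sub>j\<close> with eigenlines \<open>p\<^sub>i\<close>, \<open>p\<^sub>j\<close> for the eigenvalues \<open>-1\<close>, \<open>1\<close>.
  For any four distinct points, \<open>E\<^sub>a\<^sub>d = r E\<^sub>c\<^sub>d + (r - 1) E\<^sub>d\<^sub>b\<close> where \<open>r\<close> is their cross-ratio, which for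
  \<open>(p\<^sub>0, p\<^sub>1, p\<^sub>2, p\<^sub>3)\<close> equals \<open>t\<close>. So \<open>\<rho>(\<sigma>)\<close> is the semilinear map that sends \<open>E\<^sub>1\<^sub>2, E\<^sub>2\<^sub>3, E\<^sub>3\<^sub>1\<close> to
  their \<open>\<sigma>\<close>-translates and \<open>t\<close> to the cross-ratio of the permuted points; the relation then forces
  \<open>\<rho>(\<sigma>) E\<^sub>i\<^sub>j = E\<^bsub>\<sigma>(i)\<sigma>(j)\<^esub>\<close> for all edges. Applying \<open>\<rho>(\<sigma>)\<close> to the same relation for \<open>\<pi>\<close> shows that
  the substitutions compose, whence \<open>\<rho>\<close> is a homomorphism; it is injective because \<open>E\<^sub>i\<^sub>j\<close>
  determines its eigenlines.
\<close>

section \<open>Subrings of fields and their units\<close>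

definition units_in :: "'f::field set \<Rightarrow> 'f set" where
  "units_in R = {u \<in> R. u \<noteq> 0 \<and> inverse u \<in> R}"

lemma units_in_mem: "u \<in> units_in R \<Longrightarrow> u \<in> R"
  and units_in_nonzero: "u \<in> units_in R \<Longrightarrow> u \<noteq> 0"
  and units_in_inverse_mem: "u \<in> units_in R \<Longrightarrow> inverse u \<in> R"
  by (simp_all add: units_in_def)

locale subring =
  fixes R :: "'f::field set"
  assumes one_mem [simp]: "1 \<in> R"
    and diff_mem [simp]: "a \<in> R \<Longrightarrow> b \<in> R \<Longrightarrow> a - b \<in> R"
    and mult_mem [simp]: "a \<in> R \<Longrightarrow> b \<in> R \<Longrightarrow> a * b \<in> R"
begin

lemma zero_mem [simp]: "0 \<in> R"
  using diff_mem[OF one_mem one_mem] by simp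

lemma minus_mem [simp]: "a \<in> R \<Longrightarrow> - a \<in> R"
  using diff_mem[OF zero_mem] by simp

lemma add_mem [simp]: "a \<in> R \<Longrightarrow> b \<in> R \<Longrightarrow> a + b \<in> R"
  using diff_mem[OF _ minus_mem, of a b] by simp

lemma numeral_mem [simp]: "numeral n \<in> R"
  by (induction n) (simp_all only: numeral.simps one_mem add_mem)

lemma divide_mem: "a \<in> R \<Longrightarrow> u \<in> units_in R \<Longrightarrow> a / u \<in> R"
  by (simp add: divide_inverse units_in_inverse_mem)

lemma one_unit: "1 \<in> units_in R"
  and minus_unit: "u \<in> units_in R \<Longrightarrow> - u \<in> units_in R"
  and mult_unit: "u \<in> units_in R \<Longrightarrow> v \<in> units_in R \<Longrightarrow> u * v \<in> units_in R"
  and divide_unit: "u \<in> units_in R \<Longrightarrow> v \<in> units_in R \<Longrightarrow> u / v \<in> units_in R"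
  by (simp_all add: units_in_def divide_inverse)

lemma power_unit: "u \<in> units_in R \<Longrightarrow> u ^ n \<in> units_in R"
  by (induction n) (simp_all add: one_unit mult_unit)

end

locale subring_hom = subring R for R :: "'f::field set" +
  fixes h :: "'f \<Rightarrow> 'g::field"
  assumes hom_one [simp]: "h 1 = 1"
    and hom_add [simp]: "a \<in> R \<Longrightarrow> b \<in> R \<Longrightarrow> h (a + b) = h a + h b"
    and hom_mult [simp]: "a \<in> R \<Longrightarrow> b \<in> R \<Longrightarrow> h (a * b) = h a * h b"
begin

lemma hom_zero [simp]: "h 0 = 0"
  using hom_add[OF zero_mem zero_mem] by (metis add_0 add_cancel_right_right)

lemma hom_minus [simp]: "a \<in> R \<Longrightarrow> h (- a) = - h a"
  using hom_add[of a "- a"] by (simp add: add_eq_0_iff)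

lemma hom_diff [simp]: "a \<in> R \<Longrightarrow> b \<in> R \<Longrightarrow> h (a - b) = h a - h b"
  using hom_add[of a "- b"] by simp

lemma hom_numeral [simp]: "h (numeral n) = numeral n"
  by (induction n) (simp_all only: numeral.simps hom_one hom_add one_mem add_mem numeral_mem)

lemma hom_power [simp]: "u \<in> units_in R \<Longrightarrow> h (u ^ n) = h u ^ n"
  by (induction n) (simp_all add: power_unit units_in_mem)

lemma hom_inverse:
  assumes "u \<in> units_in R"
  shows "h (inverse u) = inverse (h u)"
proof -
  have "h u * h (inverse u) = 1"
    using assms by (simp add: units_in_def flip: hom_mult)
  then show ?thesis
    by (rule inverse_unique[symmetric])
qed

lemma hom_divide: "a \<in> R \<Longrightarrow> u \<in> units_in R \<Longrightarrow> h (a / u) = h a / h u"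
  by (simp add: divide_inverse units_in_inverse_mem hom_inverse)

end

locale subring_endo = subring_hom R h for R :: "'f::field set" and h :: "'f \<Rightarrow> 'f" +
  assumes hom_mem [simp]: "a \<in> R \<Longrightarrow> h a \<in> R"

lemma subring_UNIV: "subring UNIV"
  by unfold_locales simp_all

lemma (in subring) subring_endo_ident: "subring_endo R (\<lambda>a. a)"
  by unfold_locales simp_all

section \<open>Traceless two-by-two matrices\<close>

interpretation smat: module "smat :: 'f::comm_ring_1 \<Rightarrow> _"
  by unfold_locales (simp_all add: smat_def vec_eq_iff algebra_simps)

lemma smat_nth [simp]: "smat c M $ i $ j = c * M $ i $ j"
  by (simp add: smat_def)

lemma mat2_nth [simp]:
  "mat2 a b c d $ 1 $ 1 = a" "mat2 a b c d $ 1 $ 2 = b"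
  "mat2 a b c d $ 2 $ 1 = c" "mat2 a b c d $ 2 $ 2 = d"
  by (simp_all add: mat2_def)

lemma matrix_2_eq_iff:
  "M = N \<longleftrightarrow> M $ 1 $ 1 = N $ 1 $ 1 \<and> M $ 1 $ 2 = N $ 1 $ 2 \<and>
     M $ 2 $ 1 = N $ 2 $ 1 \<and> M $ 2 $ 2 = N $ 2 $ 2" for M N :: "'f ^ 2 ^ 2"
  by (auto simp: vec_eq_iff forall_2)

lemma smat_left_imp_eq: "smat c M = smat c N \<Longrightarrow> c \<noteq> 0 \<Longrightarrow> M = N" for c :: "'f::field"
  by (simp add: matrix_2_eq_iff)

lemma smat_right_imp_eq: "smat c M = smat d M \<Longrightarrow> M \<noteq> 0 \<Longrightarrow> c = d" for c :: "'f::field"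
  by (auto simp: matrix_2_eq_iff)

lemma brk_nth:
  "brk M N $ i $ j = M $ i $ 1 * N $ 1 $ j + M $ i $ 2 * N $ 2 $ j
     - (N $ i $ 1 * M $ 1 $ j + N $ i $ 2 * M $ 2 $ j)"
  by (simp add: brk_def matrix_matrix_mult_def sum_2)

lemma brk_self: "brk M M = 0"
  and brk_swap: "brk M N = - brk N M"
  and brk_add_left: "brk (M + N) L = brk M L + brk N L"
  and brk_add_right: "brk L (M + N) = brk L M + brk L N"
  and brk_smat_left: "brk (smat c M) L = smat c (brk M L)"
  and brk_smat_right: "brk L (smat c M) = smat c (brk L M)"
  by (simp_all add: matrix_2_eq_iff brk_nth algebra_simps)

lemma trace0_iff: "trace0 M \<longleftrightarrow> M $ 2 $ 2 = - M $ 1 $ 1"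
  by (simp add: trace0_def eq_neg_iff_add_eq_0 add.commute)

lemma trace0_brk: "trace0 (brk M N)"
  by (simp add: trace0_iff brk_nth algebra_simps)

lemma coords_add [simp]:
    "cx (M + N) = cx M + cx N" "cy (M + N) = cy M + cy N" "cz (M + N) = cz M + cz N"
  and coords_diff [simp]:
    "cx (M - N) = cx M - cx N" "cy (M - N) = cy M - cy N" "cz (M - N) = cz M - cz N"
  and coords_minus [simp]: "cx (- M) = - cx M" "cy (- M) = - cy M" "cz (- M) = - cz M"
  and coords_smat [simp]:
    "cx (smat c M) = c * cx M" "cy (smat c M) = c * cy M" "cz (smat c M) = c * cz M"
  by (simp_all add: cx_def cy_def cz_def add_divide_distrib diff_divide_distrib
      distrib_left right_diff_distrib)

lemma coords_basis [simp]:
  assumes "(2::'f::field) \<noteq> 0"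
  shows "cx (xm :: 'f ^ 2 ^ 2) = 1" "cy (xm :: 'f ^ 2 ^ 2) = 0" "cz (xm :: 'f ^ 2 ^ 2) = 0"
    "cx (ym :: 'f ^ 2 ^ 2) = 0" "cy (ym :: 'f ^ 2 ^ 2) = 1" "cz (ym :: 'f ^ 2 ^ 2) = 0"
    "cx (zm :: 'f ^ 2 ^ 2) = 0" "cy (zm :: 'f ^ 2 ^ 2) = 0" "cz (zm :: 'f ^ 2 ^ 2) = 1"
  using assms by (simp_all add: cx_def cy_def cz_def xm_def ym_def zm_def)

lemma trace0_expand:
  fixes M :: "'f::field ^ 2 ^ 2"
  assumes "(2::'f) \<noteq> 0" "trace0 M"
  shows "M = smat (cx M) xm + smat (cy M) ym + smat (cz M) zm"
  using assms by (simp add: trace0_iff matrix_2_eq_iff xm_def ym_def zm_def cx_def cy_def cz_def)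

lemma trace0_coords_eqI:
  fixes M N :: "'f::field ^ 2 ^ 2"
  assumes "(2::'f) \<noteq> 0" "trace0 M" "trace0 N" "cx M = cx N" "cy M = cy N" "cz M = cz N"
  shows "M = N"
  using trace0_expand[OF assms(1,2)] trace0_expand[OF assms(1,3)] assms(4-6) by simp

definition equitable_triple :: "'f::comm_ring_1 ^ 2 ^ 2 \<Rightarrow> 'f ^ 2 ^ 2 \<Rightarrow> 'f ^ 2 ^ 2 \<Rightarrow> bool" where
  "equitable_triple u v w \<longleftrightarrow>
     brk u v = smat 2 (u + v) \<and> brk v w = smat 2 (v + w) \<and> brk w u = smat 2 (w + u)"

lemma equitable_triple_rotate: "equitable_triple u v w \<Longrightarrow> equitable_triple v w u"
  by (simp add: equitable_triple_def)

lemma equitable_triple_basis: "equitable_triple xm ym zm"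
  by (simp add: equitable_triple_def matrix_2_eq_iff brk_nth xm_def ym_def zm_def)

lemma equitable_triple_uminus_swap:
  assumes "equitable_triple u v w"
  shows "equitable_triple (- u) (- w) (- v)"
proof -
  have brk_uminus: "brk (- M) (- N) = - brk N M" for M N :: "'a ^ 2 ^ 2"
    by (simp add: brk_def matrix_2_eq_iff matrix_matrix_mult_def sum_2)
  show ?thesis
    using assms by (simp add: equitable_triple_def brk_uminus algebra_simps)
qed

lemma equitable_triple_brk:
  fixes u v w :: "'f::comm_ring_1 ^ 2 ^ 2"
  assumes "equitable_triple u v w"
  shows "brk (smat a u + smat b v + smat c w) (smat a' u + smat b' v + smat c' w) =
    smat (2 * (a * b' - b * a' + c * a' - a * c')) u
      + smat (2 * (a * b' - b * a' + b * c' - c * b')) v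
      + smat (2 * (b * c' - c * b' + c * a' - a * c')) w"
proof -
  have uv: "brk u v = smat 2 (u + v)" "brk v u = - smat 2 (u + v)"
    and vw: "brk v w = smat 2 (v + w)" "brk w v = - smat 2 (v + w)"
    and wu: "brk w u = smat 2 (w + u)" "brk u w = - smat 2 (w + u)"
    using assms brk_swap unfolding equitable_triple_def by metis+
  show ?thesis
    by (simp add: brk_add_left brk_add_right brk_smat_left brk_smat_right brk_self uv vw wu)
      (simp add: matrix_2_eq_iff algebra_simps)
qed

lemma coords_brk:
  fixes M N :: "'f::field ^ 2 ^ 2"
  assumes "(2::'f) \<noteq> 0" "trace0 M" "trace0 N"
  shows "cx (brk M N) = 2 * (cx M * cy N - cy M * cx N + cz M * cx N - cx M * cz N)"
    "cy (brk M N) = 2 * (cx M * cy N - cy M * cx N + cy M * cz N - cz M * cy N)"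
    "cz (brk M N) = 2 * (cy M * cz N - cz M * cy N + cz M * cx N - cx M * cz N)"
proof -
  have "brk M N = brk (smat (cx M) xm + smat (cy M) ym + smat (cz M) zm)
      (smat (cx N) xm + smat (cy N) ym + smat (cz N) zm)"
    using trace0_expand[OF assms(1,2)] trace0_expand[OF assms(1,3)] by simp
  note brk_expand = this[unfolded equitable_triple_brk[OF equitable_triple_basis]]
  show "cx (brk M N) = 2 * (cx M * cy N - cy M * cx N + cz M * cx N - cx M * cz N)"
    "cy (brk M N) = 2 * (cx M * cy N - cy M * cx N + cy M * cz N - cz M * cy N)"
    "cz (brk M N) = 2 * (cy M * cz N - cz M * cy N + cz M * cx N - cx M * cz N)"
    unfolding brk_expand using assms(1) by simp_all
qed

definition sl2_over :: "'f::field set \<Rightarrow> ('f ^ 2 ^ 2) set" where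
  "sl2_over R = {M. trace0 M \<and> (\<forall>i j. M $ i $ j \<in> R)}"

lemma sl2_over_UNIV: "sl2_over UNIV = sl2"
  and sl2_over_Aset: "sl2_over Aset = gset"
  by (simp_all add: sl2_over_def sl2_def gset_def)

lemma sl2_trace0: "M \<in> sl2 \<Longrightarrow> trace0 M"
  by (simp add: sl2_def)

lemma sl2_over_trace0: "M \<in> sl2_over R \<Longrightarrow> trace0 M"
  and sl2_over_nth: "M \<in> sl2_over R \<Longrightarrow> M $ i $ j \<in> R"
  by (simp_all add: sl2_over_def)

context subring
begin

lemma sl2_over_zero: "0 \<in> sl2_over R"
  and sl2_over_add: "M \<in> sl2_over R \<Longrightarrow> N \<in> sl2_over R \<Longrightarrow> M + N \<in> sl2_over R"
  and sl2_over_minus: "M \<in> sl2_over R \<Longrightarrow> - M \<in> sl2_over R"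
  and sl2_over_smat: "a \<in> R \<Longrightarrow> M \<in> sl2_over R \<Longrightarrow> smat a M \<in> sl2_over R"
  by (simp_all add: sl2_over_def trace0_iff)

lemma basis_mem: "xm \<in> sl2_over R" "ym \<in> sl2_over R" "zm \<in> sl2_over R"
  by (simp_all add: sl2_over_def forall_2 trace0_def xm_def ym_def zm_def)

lemma sl2_over_brk: "M \<in> sl2_over R \<Longrightarrow> N \<in> sl2_over R \<Longrightarrow> brk M N \<in> sl2_over R"
  by (simp add: sl2_over_def trace0_brk brk_nth)

lemma coords_mem:
  assumes "2 \<in> units_in R" "M \<in> sl2_over R"
  shows "cx M \<in> R" "cy M \<in> R" "cz M \<in> R"
  using assms by (simp_all add: cx_def cy_def cz_def sl2_over_nth divide_mem)

end

section \<open>Semilinear maps in the basis \<open>x, y, z\<close>\<close>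

definition semilin3 ::
  "('f::field \<Rightarrow> 'g::field) \<Rightarrow> 'g ^ 2 ^ 2 \<Rightarrow> 'g ^ 2 ^ 2 \<Rightarrow> 'g ^ 2 ^ 2 \<Rightarrow> 'f ^ 2 ^ 2 \<Rightarrow> 'g ^ 2 ^ 2" where
  "semilin3 h u v w M = smat (h (cx M)) u + smat (h (cy M)) v + smat (h (cz M)) w"

lemma lin3_eq_semilin3: "lin3 u v w = semilin3 (\<lambda>a. a) u v w"
  by (simp add: fun_eq_iff lin3_def semilin3_def)

lemma tens_eq_semilin3: "tens f h = semilin3 h (lift (f xm)) (lift (f ym)) (lift (f zm))"
  by (simp add: fun_eq_iff tens_def semilin3_def)

context subring_hom
begin

lemma semilin3_basis:
  assumes "(2::'f) \<noteq> 0"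
  shows "semilin3 h u v w xm = u" "semilin3 h u v w ym = v" "semilin3 h u v w zm = w"
  using assms by (simp_all add: semilin3_def)

context
  assumes two_unit: "2 \<in> units_in R"
begin

lemma semilin3_add:
  "M \<in> sl2_over R \<Longrightarrow> N \<in> sl2_over R \<Longrightarrow>
    semilin3 h u v w (M + N) = semilin3 h u v w M + semilin3 h u v w N"
  by (simp add: semilin3_def coords_mem[OF two_unit] algebra_simps)

lemma semilin3_smat:
  "a \<in> R \<Longrightarrow> M \<in> sl2_over R \<Longrightarrow> semilin3 h u v w (smat a M) = smat (h a) (semilin3 h u v w M)"
  by (simp add: semilin3_def coords_mem[OF two_unit] algebra_simps)

lemma semilin3_minus: "M \<in> sl2_over R \<Longrightarrow> semilin3 h u v w (- M) = - semilin3 h u v w M"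
  by (simp add: semilin3_def coords_mem[OF two_unit])

lemma semilin3_brk:
  assumes "equitable_triple u v w" "M \<in> sl2_over R" "N \<in> sl2_over R"
  shows "semilin3 h u v w (brk M N) = brk (semilin3 h u v w M) (semilin3 h u v w N)"
  unfolding semilin3_def equitable_triple_brk[OF assms(1)]
  using assms(2,3) coords_mem[OF two_unit] units_in_nonzero[OF two_unit]
  by (simp add: coords_brk sl2_over_trace0)

end

end

lemma (in subring_endo) semilin3_mem:
  assumes "2 \<in> units_in R" "u \<in> sl2_over R" "v \<in> sl2_over R" "w \<in> sl2_over R" "M \<in> sl2_over R"
  shows "semilin3 h u v w M \<in> sl2_over R"
  using assms by (simp add: semilin3_def coords_mem sl2_over_add sl2_over_smat)

lemma (in subring_endo) lie_aut_semilin3: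
  assumes "2 \<in> units_in R" "equitable_triple u v w"
    and "bij_betw (semilin3 h u v w) (sl2_over R) (sl2_over R)"
    and "K \<subseteq> R" "\<And>a. a \<in> K \<Longrightarrow> h a = a"
  shows "lie_aut K (sl2_over R) (semilin3 h u v w)"
  unfolding lie_aut_def
  using assms by (auto simp: semilin3_add semilin3_smat semilin3_brk sl2_over_smat subset_iff)

section \<open>Maps of finite order\<close>

lemma bij_betw_if_funpow_id:
  assumes "\<And>s. s \<in> S \<Longrightarrow> f s \<in> S" "0 < n" "\<And>s. s \<in> S \<Longrightarrow> (f ^^ n) s = s"
  shows "bij_betw f S S"
proof (rule bij_betw_byWitness[where f' = "f ^^ (n - 1)"])
  have "(f ^^ m) s \<in> S" if "s \<in> S" for m s
    using that assms(1) by (induction m) auto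
  then show "(f ^^ (n - 1)) ` S \<subseteq> S"
    by blast
  have "f ((f ^^ (n - 1)) s) = (f ^^ n) s" "(f ^^ (n - 1)) (f s) = (f ^^ n) s" for s
    using assms(2) by (cases n; simp add: funpow_swap1)+
  then show "\<forall>s\<in>S. (f ^^ (n - 1)) (f s) = s" "\<forall>s\<in>S. f ((f ^^ (n - 1)) s) = s"
    using assms(3) by simp_all
qed (use assms(1) in blast)

lemma funpow_fixpoint_mult:
  assumes "(f ^^ m) s = s"
  shows "(f ^^ (m * k)) s = s"
  unfolding funpow_mult[symmetric] using assms by (induction k) simp_all

text \<open>A common fixed point of \<open>f ^^ m\<close> and \<open>f ^^ n\<close> is a fixed point of \<open>f ^^ gcd m n\<close>, which here is \<open>f\<close>.\<close>
lemma order_on_primeI: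
  assumes "prime n" "\<And>s. s \<in> S \<Longrightarrow> (f ^^ n) s = s" "s \<in> S" "f s \<noteq> s"
  shows "order_on S f n"
proof -
  have "(f ^^ m) s \<noteq> s" if m: "0 < m" "m < n" for m
  proof
    assume fixed: "(f ^^ m) s = s"
    have "coprime m n"
      using assms(1) m by (metis coprime_commute nat_dvd_not_less prime_imp_coprime)
    then obtain a b where "m * a = Suc (n * b)"
      using bezout_nat[of m n] m by auto
    then have "(f ^^ (m * a)) s = f ((f ^^ (n * b)) s)"
      by simp
    then show False
      using assms(2-4) fixed by (simp add: funpow_fixpoint_mult)
  qed
  then show ?thesis
    unfolding order_on_def using assms(1-3) prime_gt_0_nat by blast
qed

section \<open>Automorphisms of \<open>sl\<^sub>2(k)\<close>\<close>

lemma two_neq_zero_of_CHAR: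
  assumes "CHAR('f::field) \<noteq> 2"
  shows "(2::'f) \<noteq> 0"
  using assms CHAR_eq_posI[of 2, where 'a = 'f] by (auto simp: less_2_cases_iff)

lemmas basis_in_sl2 = subring.basis_mem[OF subring_UNIV, unfolded sl2_over_UNIV]
  and uminus_in_sl2 = subring.sl2_over_minus[OF subring_UNIV, unfolded sl2_over_UNIV]

lemma lin3_in_sl2: "u \<in> sl2 \<Longrightarrow> v \<in> sl2 \<Longrightarrow> w \<in> sl2 \<Longrightarrow> lin3 u v w M \<in> sl2"
  by (simp add: sl2_def lin3_def trace0_iff)

lemma phiS_in_sl2: "phiS M \<in> sl2"
  and tauS_in_sl2: "tauS M \<in> sl2"
  by (simp_all add: phiS_def tauS_def lin3_in_sl2 basis_in_sl2 uminus_in_sl2)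

context
  assumes two: "(2::'k::field) \<noteq> 0"
begin

lemma phiS_basis:
    "phiS xm = (ym :: 'k ^ 2 ^ 2)" "phiS ym = (zm :: 'k ^ 2 ^ 2)" "phiS zm = (xm :: 'k ^ 2 ^ 2)"
  and tauS_basis:
    "tauS xm = - (xm :: 'k ^ 2 ^ 2)" "tauS ym = - (zm :: 'k ^ 2 ^ 2)"
    "tauS zm = - (ym :: 'k ^ 2 ^ 2)"
  using two by (simp_all add: phiS_def tauS_def lin3_def)

lemma coords_phiS:
  fixes M :: "'k ^ 2 ^ 2"
  shows "cx (phiS M) = cz M" "cy (phiS M) = cx M" "cz (phiS M) = cy M"
  using two by (simp_all add: phiS_def lin3_def)

lemma coords_tauS:
  fixes M :: "'k ^ 2 ^ 2"
  shows "cx (tauS M) = - cx M" "cy (tauS M) = - cz M" "cz (tauS M) = - cy M"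
  using two by (simp_all add: tauS_def lin3_def)

lemma phiS_funpow_3: "M \<in> sl2 \<Longrightarrow> (phiS ^^ 3) M = (M :: 'k ^ 2 ^ 2)"
  by (rule trace0_coords_eqI[OF two])
    (simp_all add: sl2_trace0 eval_nat_numeral phiS_in_sl2 coords_phiS)

lemma tauS_funpow_2: "M \<in> sl2 \<Longrightarrow> (tauS ^^ 2) M = (M :: 'k ^ 2 ^ 2)"
  by (rule trace0_coords_eqI[OF two])
    (simp_all add: sl2_trace0 eval_nat_numeral tauS_in_sl2 coords_tauS)

lemma lie_aut_lin3_if_finite_order:
  fixes u v w :: "'k ^ 2 ^ 2"
  assumes "equitable_triple u v w" "u \<in> sl2" "v \<in> sl2" "w \<in> sl2"
    and "0 < n" "\<And>M. M \<in> sl2 \<Longrightarrow> (lin3 u v w ^^ n) M = M"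
  shows "lie_aut UNIV sl2 (lin3 u v w)"
proof -
  have "2 \<in> units_in (UNIV :: 'k set)"
    using two by (simp add: units_in_def)
  moreover have "bij_betw (lin3 u v w) sl2 sl2"
    using assms(2-6) by (intro bij_betw_if_funpow_id[of _ _ n] lin3_in_sl2)
  ultimately show ?thesis
    using assms(1) subring_endo.lie_aut_semilin3[OF subring.subring_endo_ident[OF subring_UNIV]]
    by (simp add: sl2_over_UNIV lin3_eq_semilin3)
qed

lemma lie_aut_phiS: "lie_aut UNIV sl2 (phiS :: 'k ^ 2 ^ 2 \<Rightarrow> _)"
  using lie_aut_lin3_if_finite_order
      [OF equitable_triple_rotate[OF equitable_triple_basis], where n = 3] phiS_funpow_3
  by (simp add: phiS_def basis_in_sl2)

lemma lie_aut_tauS: "lie_aut UNIV sl2 (tauS :: 'k ^ 2 ^ 2 \<Rightarrow> _)"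
  using lie_aut_lin3_if_finite_order
      [OF equitable_triple_uminus_swap[OF equitable_triple_basis], where n = 2] tauS_funpow_2
  by (simp add: tauS_def basis_in_sl2 uminus_in_sl2)

lemma order_on_phiS: "order_on (sl2 :: ('k ^ 2 ^ 2) set) phiS 3"
proof (rule order_on_primeI)
  show "phiS xm \<noteq> (xm :: 'k ^ 2 ^ 2)"
    using two unfolding phiS_basis by (simp add: matrix_2_eq_iff xm_def ym_def)
qed (simp_all add: phiS_funpow_3 basis_in_sl2)

lemma order_on_tauS: "order_on (sl2 :: ('k ^ 2 ^ 2) set) tauS 2"
proof (rule order_on_primeI)
  show "tauS ym \<noteq> (ym :: 'k ^ 2 ^ 2)"
    using two unfolding tauS_basis by (simp add: matrix_2_eq_iff ym_def zm_def)
qed (simp_all add: tauS_funpow_2 basis_in_sl2)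

end

section \<open>Substitution in rational functions\<close>

lemma emb_0 [simp]: "emb 0 = 0"
  and emb_1 [simp]: "emb 1 = 1"
  and emb_add [simp]: "emb (a + b) = emb a + emb b"
  and emb_mult [simp]: "emb (a * b) = emb a * emb b"
  and emb_minus [simp]: "emb (- a) = - emb a"
  by (simp_all add: emb_def one_pCons[symmetric] flip: to_fract_add to_fract_mult to_fract_uminus)

lemma emb_eq_0_iff [simp]: "emb a = 0 \<longleftrightarrow> a = 0"
  by (simp add: emb_def)

lemma emb_numeral [simp]: "emb (numeral n) = numeral n"
  by (induction n) (simp_all only: numeral.simps emb_1 emb_add)

lemma T_neq [simp]: "(T :: 'k::field rf) \<noteq> 0" "(T :: 'k rf) \<noteq> 1"
  by (simp_all add: T_def one_pCons flip: to_fract_1)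

lemma one_minus_T: "1 - T = to_fract [:1, -1:]"
  by (simp add: T_def one_pCons flip: to_fract_1 to_fract_diff)

lemma to_fract_pCons: "to_fract (pCons c p) = emb c + T * to_fract p"
  by (simp add: emb_def T_def flip: to_fract_add to_fract_mult)

lemma to_fract_power: "to_fract (p ^ n) = to_fract p ^ n"
  by (induction n) simp_all

definition peval :: "'k::field rf \<Rightarrow> 'k poly \<Rightarrow> 'k rf" where
  "peval s p = poly (map_poly emb p) s"

lemma peval_0 [simp]: "peval s 0 = 0"
  and peval_pCons [simp]: "peval s (pCons c p) = emb c + s * peval s p"
  by (simp_all add: peval_def map_poly_pCons)

lemma peval_1 [simp]: "peval s 1 = 1"
  by (simp add: one_pCons)

lemma peval_add [simp]: "peval s (p + q) = peval s p + peval s q"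
  by (induction p q rule: poly_induct2) (simp_all add: algebra_simps)

lemma peval_smult [simp]: "peval s (smult c p) = emb c * peval s p"
  by (induction p) (simp_all add: algebra_simps)

lemma peval_mult [simp]: "peval s (p * q) = peval s p * peval s q"
  by (induction p) (simp_all add: algebra_simps)

lemma peval_power [simp]: "peval s (p ^ n) = peval s p ^ n"
  by (induction n) simp_all

definition regular_at :: "'k::field rf \<Rightarrow> 'k rf set" where
  "regular_at s = {Fract p q | p q. peval s q \<noteq> 0}"

lemma regular_atI: "peval s q \<noteq> 0 \<Longrightarrow> Fract p q \<in> regular_at s"
  by (auto simp: regular_at_def)

lemma subst_rf_Fract:
  assumes "peval s q \<noteq> 0"
  shows "subst_rf s (Fract p q) = peval s p / peval s q"
  unfolding subst_rf_def peval_def[symmetric]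
proof (rule some_equality)
  show "\<exists>p' q'. Fract p q = Fract p' q' \<and> q' \<noteq> 0 \<and> peval s q' \<noteq> 0
      \<and> peval s p / peval s q = peval s p' / peval s q'"
    using assms peval_0 by metis
next
  fix v
  assume "\<exists>p' q'. Fract p q = Fract p' q' \<and> q' \<noteq> 0 \<and> peval s q' \<noteq> 0 \<and> v = peval s p' / peval s q'"
  then obtain p' q' where representative: "Fract p q = Fract p' q'" "q' \<noteq> 0" "peval s q' \<noteq> 0"
    and v: "v = peval s p' / peval s q'"
    by blast
  have "q \<noteq> 0"
    using assms by auto
  then have "p * q' = p' * q"
    using representative by (simp add: eq_fract)
  then have "peval s p * peval s q' = peval s p' * peval s q"
    by (metis peval_mult)
  then show "v = peval s p / peval s q"
    unfolding v using representative assms by (simp add: frac_eq_eq)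
qed

lemma subring_hom_subst_rf: "subring_hom (regular_at s) (subst_rf s)"
proof
  show "1 \<in> regular_at s" "subst_rf s 1 = 1"
    using regular_atI[of s 1 1] subst_rf_Fract[of s 1 1] by (simp_all flip: One_fract_def)
next
  fix f g
  assume "f \<in> regular_at s" "g \<in> regular_at s"
  then obtain p q p' q' where f: "f = Fract p q" "peval s q \<noteq> 0"
      and g: "g = Fract p' q'" "peval s q' \<noteq> 0"
    by (auto simp: regular_at_def)
  then have "q \<noteq> 0" "q' \<noteq> 0"
    by auto
  then show "f - g \<in> regular_at s" "f * g \<in> regular_at s"
    "subst_rf s (f + g) = subst_rf s f + subst_rf s g"
    "subst_rf s (f * g) = subst_rf s f * subst_rf s g"
    using f g by (simp_all add: regular_atI subst_rf_Fract add_frac_eq mult.commute)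
qed

lemma subst_rf_to_fract: "subst_rf s (to_fract p) = peval s p"
  by (simp add: to_fract_def subst_rf_Fract)

lemma subst_rf_emb [simp]: "subst_rf s (emb c) = emb c"
  by (subst (1) emb_def) (simp add: subst_rf_to_fract)

lemma subst_rf_T [simp]: "subst_rf s T = s"
  by (simp add: T_def subst_rf_to_fract)

section \<open>The algebra \<open>\<A>\<close> and its endomorphisms\<close>

lemma Aset_eq_Fract: "Aset = {Fract p ([:0, 1:] ^ a * [:1, -1:] ^ b) | p a b. True}"
  by (simp add: Aset_def Fract_conv_to_fract to_fract_power flip: one_minus_T T_def)

lemma Aset_FractI: "Fract p ([:0, 1:] ^ a * [:1, -1:] ^ b) \<in> Aset"
  by (auto simp: Aset_eq_Fract)

interpretation A: subring "Aset :: 'k::field rf set"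
proof
  show "1 \<in> (Aset :: 'k rf set)"
    using Aset_FractI[of 1 0 0] by (simp flip: One_fract_def)
next
  fix f g :: "'k rf"
  assume "f \<in> Aset" "g \<in> Aset"
  then obtain p a b p' a' b' where f: "f = Fract p ([:0, 1:] ^ a * [:1, -1:] ^ b)"
      and g: "g = Fract p' ([:0, 1:] ^ a' * [:1, -1:] ^ b')"
    by (auto simp: Aset_eq_Fract)
  have denominator: "([:0, 1:] ^ a * [:1, -1:] ^ b) * ([:0, 1:] ^ a' * [:1, -1:] ^ b') =
      ([:0, 1:] ^ (a + a') * [:1, -1:] ^ (b + b') :: 'k poly)"
    by (simp add: power_add mult_ac)
  show "f - g \<in> Aset" "f * g \<in> Aset"
    unfolding f g by (simp_all add: denominator Aset_FractI)
qed

lemma to_fract_in_Aset: "to_fract p \<in> Aset"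
  using Aset_FractI[of p 0 0] by (simp add: to_fract_def)

lemma emb_in_Aset: "emb c \<in> Aset"
  unfolding emb_def by (rule to_fract_in_Aset)

lemma T_in_Aset: "T \<in> Aset"
  unfolding T_def by (rule to_fract_in_Aset)

lemma T_unit: "T \<in> units_in (Aset :: 'k::field rf set)"
  and one_minus_T_unit: "1 - T \<in> units_in (Aset :: 'k rf set)"
proof -
  have "inverse T = Fract 1 [:0, 1 :: 'k:]" "inverse (1 - T) = Fract 1 [:1, -1 :: 'k:]"
    unfolding one_minus_T by (simp_all add: T_def to_fract_def)
  then show "T \<in> units_in (Aset :: 'k rf set)" "1 - T \<in> units_in (Aset :: 'k rf set)"
    using Aset_FractI[of "1 :: 'k poly" 1 0] Aset_FractI[of "1 :: 'k poly" 0 1]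
    by (simp_all add: units_in_def T_in_Aset)
qed

lemma emb_unit:
  assumes "c \<noteq> 0"
  shows "emb c \<in> units_in Aset"
proof -
  have "emb c * emb (inverse c) = 1"
    using assms by (simp flip: emb_mult)
  then have "inverse (emb c) = emb (inverse c)"
    by (rule inverse_unique)
  then show ?thesis
    using assms by (simp add: units_in_def emb_in_Aset)
qed

lemma two_unit: "(2::'k::field) \<noteq> 0 \<Longrightarrow> 2 \<in> units_in (Aset :: 'k rf set)"
  using emb_unit[of "2 :: 'k"] by simp

locale alg_endo_A = subring_endo Aset h for h :: "'k::field rf \<Rightarrow> 'k rf" +
  assumes hom_emb [simp]: "h (emb c) = emb c"
begin

lemma hom_to_fract: "h (to_fract p) = peval (h T) p"
  by (induction p) (simp_all add: to_fract_pCons to_fract_in_Aset emb_in_Aset T_in_Aset)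

lemma hom_fraction:
  "h (to_fract p / (T ^ a * (1 - T) ^ b)) = peval (h T) p / (h T ^ a * (1 - h T) ^ b)"
  by (simp add: hom_divide hom_to_fract to_fract_in_Aset T_unit one_minus_T_unit
      A.mult_unit A.power_unit units_in_mem)

end

lemma alg_endo_A_eqI:
  assumes "alg_endo_A f" "alg_endo_A g" "f T = g T" "r \<in> Aset"
  shows "f r = g r"
  using assms by (auto simp: Aset_def alg_endo_A.hom_fraction)

lemma alg_endo_A_ident: "alg_endo_A (\<lambda>r. r)"
  by (intro alg_endo_A.intro A.subring_endo_ident alg_endo_A_axioms.intro) simp

lemma alg_endo_A_comp:
  assumes "alg_endo_A f" "alg_endo_A g"
  shows "alg_endo_A (f \<circ> g)"
proof -
  interpret f: alg_endo_A f by (rule assms(1))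
  interpret g: alg_endo_A g by (rule assms(2))
  show ?thesis
    by unfold_locales simp_all
qed

lemma alg_endo_A_funpow: "alg_endo_A f \<Longrightarrow> alg_endo_A (f ^^ n)"
  by (induction n) (simp_all add: alg_endo_A_ident[folded id_def] alg_endo_A_comp)

lemma alg_endo_A_subst_rf:
  assumes "s \<in> units_in Aset" "1 - s \<in> units_in Aset"
  shows "alg_endo_A (subst_rf s)"
proof -
  interpret subst: subring_hom "regular_at s" "subst_rf s"
    by (rule subring_hom_subst_rf)
  have nonzero: "s \<noteq> 0" "1 - s \<noteq> 0"
    using assms[THEN units_in_nonzero] by simp_all
  have regular: "r \<in> regular_at s" if "r \<in> Aset" for r
    using that nonzero by (auto simp: Aset_eq_Fract intro!: regular_atI)
  have peval_mem: "peval s p \<in> Aset" for p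
    using assms by (induction p) (simp_all add: emb_in_Aset units_in_mem)
  have "subst_rf s r \<in> Aset" if "r \<in> Aset" for r
  proof -
    obtain p a b where "r = Fract p ([:0, 1:] ^ a * [:1, -1:] ^ b)"
      using \<open>r \<in> Aset\<close> by (auto simp: Aset_eq_Fract)
    then have "subst_rf s r = peval s p / (s ^ a * (1 - s) ^ b)"
      using nonzero by (simp add: subst_rf_Fract)
    then show ?thesis
      using assms peval_mem by (simp add: A.divide_mem A.mult_unit A.power_unit)
  qed
  then show ?thesis
    by unfold_locales (simp_all add: regular)
qed

lemma subst_rf_T_ident: "a \<in> Aset \<Longrightarrow> subst_rf T a = a"
  using alg_endo_A_eqI[OF alg_endo_A_subst_rf[OF T_unit one_minus_T_unit] alg_endo_A_ident] by simp

context alg_endo_A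
begin

lemma alg_endo_A: "alg_endo_A h"
  by unfold_locales

lemma funpow_fixes_Aset: "(h ^^ n) T = T \<Longrightarrow> r \<in> Aset \<Longrightarrow> (h ^^ n) r = r"
  by (rule alg_endo_A_eqI[OF alg_endo_A_funpow[OF alg_endo_A] alg_endo_A_ident])

lemma alg_aut_A_if_finite_order:
  assumes "0 < n" "(h ^^ n) T = T"
  shows "alg_aut_A h"
  unfolding alg_aut_A_def
  using bij_betw_if_funpow_id[of Aset h n] assms funpow_fixes_Aset[OF assms(2)] by simp

lemma order_on_Aset:
  assumes "prime n" "(h ^^ n) T = T" "h T \<noteq> T"
  shows "order_on Aset h n"
  using assms(3) by (intro order_on_primeI[OF assms(1) funpow_fixes_Aset[OF assms(2)]])
    (simp_all add: T_in_Aset)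

lemma tens_smat:
  assumes "2 \<in> units_in (Aset :: 'k rf set)" "a \<in> Aset" "M \<in> gset"
  shows "tens f h (smat a M) = smat (h a) (tens f h M)"
  using assms by (simp add: tens_eq_semilin3 semilin3_smat sl2_over_Aset)

end

lemma t1_unit: "t1 \<in> units_in (Aset :: 'k::field rf set)"
  and one_minus_t1_unit: "1 - t1 \<in> units_in (Aset :: 'k rf set)"
proof -
  have "t1 = - ((1 - T) / T :: 'k rf)" "1 - t1 = (1 / T :: 'k rf)"
    by (simp_all add: t1_def diff_divide_distrib)
  then show "t1 \<in> units_in (Aset :: 'k rf set)" "1 - t1 \<in> units_in (Aset :: 'k rf set)"
    using A.minus_unit[OF A.divide_unit[OF one_minus_T_unit T_unit]]
      A.divide_unit[OF A.one_unit T_unit]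
    by metis+
qed

interpretation phiA: alg_endo_A phiA
  unfolding phiA_def by (rule alg_endo_A_subst_rf[OF t1_unit one_minus_t1_unit])

interpretation tauA: alg_endo_A tauA
  unfolding tauA_def by (rule alg_endo_A_subst_rf) (simp_all add: T_unit one_minus_T_unit)

lemma phiA_T: "phiA T = t1"
  and tauA_T: "tauA T = 1 - T"
  by (simp_all add: phiA_def tauA_def)

lemma phiA_funpow_3_T: "(phiA ^^ 3) T = T"
proof -
  have phiA_shift: "phiA (1 - 1 / u) = 1 - 1 / phiA u" if "u \<in> units_in Aset" for u :: "'a rf"
    using that by (simp add: phiA.hom_divide A.divide_mem)
  have "phiA t1 = 1 - 1 / (t1 :: 'a rf)"
    by (subst (1) t1_def) (simp only: phiA_shift[OF T_unit] phiA_T)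
  then have "(phiA ^^ 3) T = 1 - 1 / (1 - 1 / (t1 :: 'a rf))"
    by (simp add: eval_nat_numeral phiA_T phiA_shift[OF t1_unit])
  also have "\<dots> = T"
    using T_neq by (simp add: t1_def field_simps)
  finally show ?thesis .
qed

lemma tauA_funpow_2_T: "(tauA ^^ 2) T = T"
  by (simp add: eval_nat_numeral tauA_T T_in_Aset)

lemma t1_neq_T: "t1 \<noteq> (T :: 'k::field rf)"
proof
  assume "t1 = (T :: 'k rf)"
  then have "T - 1 = (T * T :: 'k rf)"
    by (simp add: t1_def field_simps)
  then show False
    by (simp add: T_def one_pCons flip: to_fract_1 to_fract_diff to_fract_mult)
qed

lemma one_minus_T_neq_T: "1 - T \<noteq> T"
  unfolding one_minus_T by (simp add: T_def)

lemma alg_aut_phiA: "alg_aut_A phiA"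
  and order_on_phiA: "order_on Aset phiA 3"
  using phiA.alg_aut_A_if_finite_order[OF _ phiA_funpow_3_T]
    phiA.order_on_Aset[OF _ phiA_funpow_3_T]
  by (simp_all add: phiA_T t1_neq_T)

lemma alg_aut_tauA: "alg_aut_A tauA"
  and order_on_tauA: "order_on Aset tauA 2"
  using tauA.alg_aut_A_if_finite_order[OF _ tauA_funpow_2_T]
    tauA.order_on_Aset[OF _ tauA_funpow_2_T]
  by (simp_all add: tauA_T one_minus_T_neq_T)

section \<open>Four points on the projective line\<close>

definition wedge :: "'f::field \<times> 'f \<Rightarrow> 'f \<times> 'f \<Rightarrow> 'f" where
  "wedge a b = fst a * snd b - fst b * snd a"

definition eig_num :: "'f::field \<times> 'f \<Rightarrow> 'f \<times> 'f \<Rightarrow> 'f ^ 2 ^ 2" where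
  "eig_num a b = mat2 (- (fst a * snd b + fst b * snd a)) (2 * fst a * fst b)
     (- 2 * snd a * snd b) (fst a * snd b + fst b * snd a)"

text \<open>The traceless matrix with eigenvector \<open>a\<close> for \<open>-1\<close> and eigenvector \<open>b\<close> for \<open>1\<close>.\<close>
definition eig :: "'f::field \<times> 'f \<Rightarrow> 'f \<times> 'f \<Rightarrow> 'f ^ 2 ^ 2" where
  "eig a b = smat (1 / wedge a b) (eig_num a b)"

definition cross_ratio :: "'f::field \<times> 'f \<Rightarrow> 'f \<times> 'f \<Rightarrow> 'f \<times> 'f \<Rightarrow> 'f \<times> 'f \<Rightarrow> 'f" where
  "cross_ratio a b c d = (wedge a b * wedge c d) / (wedge a d * wedge c b)"

lemma wedge_swap: "wedge b a = - wedge a b"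
  by (simp add: wedge_def)

lemma wedge_plucker: "wedge a b * wedge c d = wedge a d * wedge c b + wedge a c * wedge b d"
  unfolding wedge_def by algebra

lemma eig_swap: "eig b a = - eig a b"
  by (simp add: eig_def wedge_swap[of b a] matrix_2_eq_iff eig_num_def algebra_simps)

lemma smat_wedge_eig: "wedge a b \<noteq> 0 \<Longrightarrow> smat (wedge a b) (eig a b) = eig_num a b"
  by (simp add: eig_def)

lemma brk_eig:
  assumes "wedge a b \<noteq> 0" "wedge b c \<noteq> 0"
  shows "brk (eig a b) (eig b c) = smat 2 (eig a b + eig b c)"
proof -
  have "smat (wedge a b * wedge b c) (brk (eig a b) (eig b c)) = brk (eig_num a b) (eig_num b c)"
    using assms by (simp add: brk_smat_left brk_smat_right mult.commute flip: smat_wedge_eig)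
  also have "\<dots> = smat 2 (smat (wedge b c) (eig_num a b) + smat (wedge a b) (eig_num b c))"
    by (simp add: eig_num_def matrix_2_eq_iff brk_nth wedge_def algebra_simps)
  also have "\<dots> = smat (wedge a b * wedge b c) (smat 2 (eig a b + eig b c))"
    using assms by (simp add: smat.scale_right_distrib mult_ac flip: smat_wedge_eig)
  finally show ?thesis
    by (rule smat_left_imp_eq) (simp add: assms)
qed

lemma one_minus_cross_ratio:
  assumes "wedge a d \<noteq> 0" "wedge b c \<noteq> 0"
  shows "1 - cross_ratio a b c d = cross_ratio a c b d"
  using assms wedge_plucker[of a b c d]
  by (simp add: cross_ratio_def wedge_swap[of c b] field_simps)

lemma one_minus_inverse_cross_ratio:
  assumes "wedge a b \<noteq> 0" "wedge c d \<noteq> 0"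
  shows "1 - 1 / cross_ratio a b c d = cross_ratio a c d b"
proof -
  have "1 - 1 / cross_ratio a b c d =
      (wedge a b * wedge c d - wedge a d * wedge c b) / (wedge a b * wedge c d)"
    using assms by (simp add: cross_ratio_def diff_divide_distrib)
  also have "wedge a b * wedge c d - wedge a d * wedge c b = wedge a c * wedge b d"
    by (simp add: wedge_plucker[of a b c d])
  finally show ?thesis
    by (simp add: cross_ratio_def wedge_swap[of d c] wedge_swap[of d b])
qed

lemma inverse_one_minus_cross_ratio:
  assumes "wedge a d \<noteq> 0" "wedge b c \<noteq> 0"
  shows "1 / (1 - cross_ratio a b c d) = cross_ratio a d b c"
  unfolding one_minus_cross_ratio[OF assms]
  by (simp add: cross_ratio_def wedge_swap[of c b] wedge_swap[of d b])

lemma eig_cross_ratio: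
  assumes "wedge a d \<noteq> 0" "wedge c b \<noteq> 0" "wedge c d \<noteq> 0" "wedge d b \<noteq> 0"
  shows "eig a d = smat (cross_ratio a b c d) (eig c d) + smat (cross_ratio a b c d - 1) (eig d b)"
proof -
  let ?D = "wedge a d * wedge c b"
  have "?D * cross_ratio a b c d = wedge a b * wedge c d"
    using assms by (simp add: cross_ratio_def)
  moreover from this have "?D * (cross_ratio a b c d - 1) = - wedge a c * wedge d b"
    by (simp add: right_diff_distrib wedge_plucker[of a b c d] wedge_swap[of d b])
  ultimately have
    "smat ?D (smat (cross_ratio a b c d) (eig c d) + smat (cross_ratio a b c d - 1) (eig d b)) =
      smat (wedge a b) (smat (wedge c d) (eig c d))
        + smat (- wedge a c) (smat (wedge d b) (eig d b))"
    by (simp only: smat.scale_right_distrib smat.scale_scale)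
  also have "\<dots> = smat (wedge a b) (eig_num c d) + smat (- wedge a c) (eig_num d b)"
    by (simp only: assms[THEN smat_wedge_eig])
  also have "\<dots> = smat (wedge c b) (eig_num a d)"
    by (simp add: eig_num_def matrix_2_eq_iff wedge_def algebra_simps)
  also have "\<dots> = smat ?D (eig a d)"
    using assms by (simp add: mult.commute flip: smat_wedge_eig)
  finally show ?thesis
    by (rule smat_left_imp_eq[symmetric]) (simp add: assms)
qed

lemma wedge_eq_0_if_eig_eq:
  assumes "eig a b = eig c d" "wedge a b \<noteq> 0" "wedge c d \<noteq> 0" "(2::'f::field) \<noteq> 0"
  shows "wedge a c = (0 :: 'f)"
proof (rule ccontr)
  assume "wedge a c \<noteq> 0"
  have "smat (wedge c d) (eig_num a b) = smat (wedge a b) (eig_num c d)"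
    using assms(1-3) by (simp add: mult.commute flip: smat_wedge_eig)
  then have "2 * wedge a b * wedge a c * fst d = 0" "2 * wedge a b * wedge a c * snd d = 0"
    unfolding eig_num_def matrix_2_eq_iff wedge_def by (simp_all, algebra+)
  then have "fst d = 0" "snd d = 0"
    using assms(2,4) \<open>wedge a c \<noteq> 0\<close> by auto
  then show False
    using assms(3) by (simp add: wedge_def)
qed

definition edge :: "(nat \<Rightarrow> 'f::field \<times> 'f) \<Rightarrow> nat \<Rightarrow> nat \<Rightarrow> 'f ^ 2 ^ 2" where
  "edge p i j = eig (p i) (p j)"

definition cross_ratio_of :: "(nat \<Rightarrow> 'f::field \<times> 'f) \<Rightarrow> 'f" where
  "cross_ratio_of p = cross_ratio (p 0) (p 1) (p 2) (p 3)"

lemma edge_swap: "edge p j i = - edge p i j"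
  unfolding edge_def by (rule eig_swap)

lemma edge_comp: "edge (p \<circ> \<sigma>) i j = edge p (\<sigma> i) (\<sigma> j)"
  by (simp add: edge_def)

text \<open>The six edges carry the orientation in which the generators appear in the definition of \<open>\<Psi>\<close>.\<close>
lemma tetrahedron_edge_cases:
  assumes "i \<in> {0..3}" "j \<in> {0..3}" "i \<noteq> j"
    and "P 1 2" "P 2 3" "P 3 1" "P 0 3" "P 0 1" "P 0 2"
    and "\<And>i j. i \<in> {0..3} \<Longrightarrow> j \<in> {0..3} \<Longrightarrow> i \<noteq> j \<Longrightarrow> P i j \<Longrightarrow> P j i"
  shows "P i (j :: nat)"
proof -
  have "i = 0 \<or> i = 1 \<or> i = 2 \<or> i = 3" "j = 0 \<or> j = 1 \<or> j = 2 \<or> j = 3"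
    using assms(1,2) by auto
  moreover have "P 2 1" "P 3 2" "P 1 3" "P 3 0" "P 1 0" "P 2 0"
    by (rule assms(10); use assms(4-9) in simp)+
  ultimately show ?thesis
    using assms(3-9) by (elim disjE) simp_all
qed

locale four_points = subring R for R :: "'f::field set" +
  fixes p :: "nat \<Rightarrow> 'f \<times> 'f"
  assumes coord_mem: "i \<in> {0..3} \<Longrightarrow> fst (p i) \<in> R" "i \<in> {0..3} \<Longrightarrow> snd (p i) \<in> R"
    and wedge_unit: "i \<in> {0..3} \<Longrightarrow> j \<in> {0..3} \<Longrightarrow> i \<noteq> j \<Longrightarrow> wedge (p i) (p j) \<in> units_in R"
begin

lemma wedge_nonzero: "i \<in> {0..3} \<Longrightarrow> j \<in> {0..3} \<Longrightarrow> i \<noteq> j \<Longrightarrow> wedge (p i) (p j) \<noteq> 0"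
  using wedge_unit units_in_nonzero by blast

lemma edge_mem:
  assumes "i \<in> {0..3}" "j \<in> {0..3}" "i \<noteq> j"
  shows "edge p i j \<in> sl2_over R"
proof -
  have "eig_num (p i) (p j) \<in> sl2_over R"
    using coord_mem assms
    by (simp add: sl2_over_def forall_2 trace0_def eig_num_def del: atLeastAtMost_iff)
  then show ?thesis
    unfolding edge_def eig_def by (intro sl2_over_smat divide_mem one_mem wedge_unit assms)
qed

lemma equitable_triple_edge: "equitable_triple (edge p 1 2) (edge p 2 3) (edge p 3 1)"
  unfolding equitable_triple_def edge_def by (intro conjI brk_eig wedge_nonzero) simp_all

lemma cross_ratio_of_unit: "cross_ratio_of p \<in> units_in R"
  unfolding cross_ratio_of_def cross_ratio_def by (intro divide_unit mult_unit wedge_unit) simp_all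

lemma one_minus_cross_ratio_of_unit: "1 - cross_ratio_of p \<in> units_in R"
proof -
  have "1 - cross_ratio_of p = cross_ratio (p 0) (p 2) (p 1) (p 3)"
    unfolding cross_ratio_of_def by (intro one_minus_cross_ratio wedge_nonzero) simp_all
  then show ?thesis
    unfolding cross_ratio_def by (simp only:) (intro divide_unit mult_unit wedge_unit; simp)
qed

lemma edge_0_3:
  "edge p 0 3 = smat (cross_ratio_of p) (edge p 2 3) + smat (cross_ratio_of p - 1) (edge p 3 1)"
  unfolding edge_def cross_ratio_of_def by (intro eig_cross_ratio wedge_nonzero) simp_all

lemma edge_0_1:
  "edge p 0 1 = smat (1 - 1 / cross_ratio_of p) (edge p 3 1)
    + smat (1 - 1 / cross_ratio_of p - 1) (edge p 1 2)"
proof -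
  have "1 - 1 / cross_ratio_of p = cross_ratio (p 0) (p 2) (p 3) (p 1)"
    unfolding cross_ratio_of_def by (intro one_minus_inverse_cross_ratio wedge_nonzero) simp_all
  then show ?thesis
    unfolding edge_def by (simp only:) (intro eig_cross_ratio wedge_nonzero; simp)
qed

lemma edge_0_2:
  "edge p 0 2 = smat (1 / (1 - cross_ratio_of p)) (edge p 1 2)
    + smat (1 / (1 - cross_ratio_of p) - 1) (edge p 2 3)"
proof -
  have "1 / (1 - cross_ratio_of p) = cross_ratio (p 0) (p 3) (p 1) (p 2)"
    unfolding cross_ratio_of_def by (intro inverse_one_minus_cross_ratio wedge_nonzero) simp_all
  then show ?thesis
    unfolding edge_def by (simp only:) (intro eig_cross_ratio wedge_nonzero; simp)
qed

lemma edge_eq_imp_eq: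
  assumes "(2::'f) \<noteq> 0" "edge p i j = edge p i' j'"
    and "i \<in> {0..3}" "j \<in> {0..3}" "i \<noteq> j" "i' \<in> {0..3}" "j' \<in> {0..3}" "i' \<noteq> j'"
  shows "i = i'"
  using wedge_eq_0_if_eig_eq[OF assms(2)[unfolded edge_def]] assms(1,3-8) wedge_nonzero by metis

lemma cross_ratio_of_eqI:
  assumes "(2::'f) \<noteq> 0" "edge p 0 3 = smat r (edge p 2 3) + smat (r - 1) (edge p 3 1)"
  shows "r = cross_ratio_of p"
proof -
  have "edge p 2 3 \<noteq> - edge p 3 1"
    using edge_eq_imp_eq[OF assms(1), of 2 3 1 3] by (auto simp flip: edge_swap)
  then have "edge p 2 3 + edge p 3 1 \<noteq> 0"
    by (simp add: add_eq_0_iff2)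
  moreover have "smat r (edge p 2 3 + edge p 3 1) =
      smat (cross_ratio_of p) (edge p 2 3 + edge p 3 1)"
    using assms(2) edge_0_3 by (simp add: algebra_simps)
  ultimately show ?thesis
    by (blast intro: smat_right_imp_eq)
qed

lemma four_points_comp:
  assumes "\<sigma> permutes {0..3}"
  shows "four_points R (p \<circ> \<sigma>)"
proof
  show "fst ((p \<circ> \<sigma>) i) \<in> R" "snd ((p \<circ> \<sigma>) i) \<in> R" if "i \<in> {0..3}" for i
    using that assms by (simp_all add: coord_mem permutes_in_image del: atLeastAtMost_iff)
  show "wedge ((p \<circ> \<sigma>) i) ((p \<circ> \<sigma>) j) \<in> units_in R" if "i \<in> {0..3}" "j \<in> {0..3}" "i \<noteq> j" for i j
    using that assms
    by (simp add: wedge_unit permutes_in_image inj_eq[OF permutes_inj] del: atLeastAtMost_iff)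
qed

end

section \<open>The edges of the tetrahedron in \<open>sl\<^sub>2 \<otimes> \<A>\<close>\<close>

declare One_nat_def [simp del]

definition pt :: "nat \<Rightarrow> 'k::field rf \<times> 'k rf" where
  "pt i = (if i = 1 then (1, 0) else if i = 2 then (1, 1) else if i = 3 then (0, 1) else (1, T))"

interpretation pt: four_points "Aset :: 'k::field rf set" pt
proof
  show "fst (pt i) \<in> (Aset :: 'k rf set)" "snd (pt i) \<in> (Aset :: 'k rf set)" for i
    by (simp_all add: pt_def T_in_Aset)
next
  fix i j :: nat
  assume "i \<in> {0..3}" "j \<in> {0..3}" "i \<noteq> j"
  then show "wedge (pt i) (pt j) \<in> units_in (Aset :: 'k rf set)"
  proof (rule tetrahedron_edge_cases)
    show "wedge (pt j) (pt i) \<in> units_in (Aset :: 'k rf set)"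
      if "wedge (pt i) (pt j) \<in> units_in (Aset :: 'k rf set)" for i j
      using A.minus_unit[OF that] by (simp add: wedge_swap[of "pt j"])
  qed (simp_all add: pt_def wedge_def A.one_unit A.minus_unit T_unit one_minus_T_unit)
qed

lemma cross_ratio_of_pt: "cross_ratio_of pt = T"
  by (simp add: cross_ratio_of_def cross_ratio_def pt_def wedge_def)

lemma X_eq_xm: "X = xm"
  and Y_eq_ym: "Y = ym"
  and Z_eq_zm: "Z = zm"
  by (simp_all add: X_def Y_def Z_def lift_def matrix_2_eq_iff xm_def ym_def zm_def)

lemma edge_pt_base: "edge pt 1 2 = X" "edge pt 2 3 = Y" "edge pt 3 1 = Z"
  by (simp_all add: X_eq_xm Y_eq_ym Z_eq_zm edge_def eig_def eig_num_def pt_def wedge_def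
      matrix_2_eq_iff xm_def ym_def zm_def)

lemma edge_pt_0:
  "edge pt 0 3 = smat T Y + smat (T - 1) Z"
  "edge pt 0 1 = smat t1 Z + smat (t1 - 1) X"
  "edge pt 0 2 = smat t2 X + smat (t2 - 1) Y"
  by (simp_all only: pt.edge_0_3 pt.edge_0_1 pt.edge_0_2 edge_pt_base cross_ratio_of_pt
      t1_def t2_def)

lemmas gset_zero = A.sl2_over_zero[unfolded sl2_over_Aset]
  and gset_add = A.sl2_over_add[unfolded sl2_over_Aset]
  and gset_smat = A.sl2_over_smat[unfolded sl2_over_Aset]
  and gset_brk = A.sl2_over_brk[unfolded sl2_over_Aset]
  and edge_pt_in_gset = pt.edge_mem[unfolded sl2_over_Aset]

section \<open>Semilinear maps carrying the tetrahedron to another one\<close>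

definition transport :: "(nat \<Rightarrow> 'k::field rf \<times> 'k rf) \<Rightarrow> 'k rf ^ 2 ^ 2 \<Rightarrow> 'k rf ^ 2 ^ 2" where
  "transport q = semilin3 (subst_rf (cross_ratio_of q)) (edge q 1 2) (edge q 2 3) (edge q 3 1)"

locale four_A_points = four_points Aset q for q :: "nat \<Rightarrow> 'k::field rf \<times> 'k rf" +
  assumes two_neq_zero: "(2::'k) \<noteq> 0"
begin

sublocale subst: alg_endo_A "subst_rf (cross_ratio_of q)"
  by (rule alg_endo_A_subst_rf[OF cross_ratio_of_unit one_minus_cross_ratio_of_unit])

lemmas two_unit_A = two_unit[OF two_neq_zero]
  and two_rf_neq_zero = units_in_nonzero[OF two_unit[OF two_neq_zero]]

lemma transport_in_gset: "M \<in> gset \<Longrightarrow> transport q M \<in> gset"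
  unfolding transport_def sl2_over_Aset[symmetric]
  by (rule subst.semilin3_mem[OF two_unit_A]) (simp_all add: edge_mem)

lemma transport_add: "M \<in> gset \<Longrightarrow> N \<in> gset \<Longrightarrow> transport q (M + N) = transport q M + transport q N"
  and transport_smat: "a \<in> Aset \<Longrightarrow> M \<in> gset \<Longrightarrow>
    transport q (smat a M) = smat (subst_rf (cross_ratio_of q) a) (transport q M)"
  and transport_minus: "M \<in> gset \<Longrightarrow> transport q (- M) = - transport q M"
  and transport_brk: "M \<in> gset \<Longrightarrow> N \<in> gset \<Longrightarrow>
    transport q (brk M N) = brk (transport q M) (transport q N)"
  unfolding transport_def sl2_over_Aset[symmetric]
  by (simp_all add: subst.semilin3_add subst.semilin3_smat subst.semilin3_minus subst.semilin3_brk
      two_unit_A equitable_triple_edge)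

lemma transport_combination:
  assumes "a \<in> Aset" "b \<in> Aset" "M \<in> gset" "N \<in> gset"
  shows "transport q (smat a M + smat b N) =
    smat (subst_rf (cross_ratio_of q) a) (transport q M)
      + smat (subst_rf (cross_ratio_of q) b) (transport q N)"
  using assms by (simp add: transport_add transport_smat gset_smat)

lemma transport_edge:
  assumes "i \<in> {0..3}" "j \<in> {0..3}" "i \<noteq> j"
  shows "transport q (edge pt i j) = edge q i j"
  using assms
proof (rule tetrahedron_edge_cases)
  show base: "transport q (edge pt 1 2) = edge q 1 2" "transport q (edge pt 2 3) = edge q 2 3"
    "transport q (edge pt 3 1) = edge q 3 1"
    unfolding transport_def edge_pt_base X_eq_xm Y_eq_ym Z_eq_zm
    by (rule subst.semilin3_basis[OF two_rf_neq_zero])+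
  note transport_simps = A.divide_mem T_unit one_minus_T_unit T_in_Aset subst.hom_divide
    edge_pt_in_gset base
  show "transport q (edge pt 0 3) = edge q 0 3"
    unfolding pt.edge_0_3 edge_0_3 cross_ratio_of_pt
    by (subst transport_combination) (simp_all add: transport_simps)
  show "transport q (edge pt 0 1) = edge q 0 1"
    unfolding pt.edge_0_1 edge_0_1 cross_ratio_of_pt
    by (subst transport_combination) (simp_all add: transport_simps)
  show "transport q (edge pt 0 2) = edge q 0 2"
    unfolding pt.edge_0_2 edge_0_2 cross_ratio_of_pt
    by (subst transport_combination) (simp_all add: transport_simps)
next
  fix i j :: nat
  assume "i \<in> {0..3}" "j \<in> {0..3}" "i \<noteq> j" "transport q (edge pt i j) = edge q i j"
  then show "transport q (edge pt j i) = edge q j i"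
    by (simp add: edge_swap[of _ j i] transport_minus edge_pt_in_gset)
qed

text \<open>The relation \<open>E\<^sub>0\<^sub>3 = r E\<^sub>2\<^sub>3 + (r - 1) E\<^sub>3\<^sub>1\<close> forces the substitutions to compose.\<close>
lemma transport_transport:
  assumes "four_A_points q'" "four_A_points q''"
    and edges: "\<And>i j. i \<in> {0..3} \<Longrightarrow> j \<in> {0..3} \<Longrightarrow> i \<noteq> j \<Longrightarrow> transport q (edge q' i j) = edge q'' i j"
    and "M \<in> gset"
  shows "transport q (transport q' M) = transport q'' M"
proof -
  interpret q': four_A_points q' by (rule assms(1))
  interpret q'': four_A_points q'' by (rule assms(2))
  note edge_q' = q'.edge_mem[unfolded sl2_over_Aset]
  have "transport q (edge q' 0 3) =
      smat (subst_rf (cross_ratio_of q) (cross_ratio_of q')) (transport q (edge q' 2 3))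
      + smat (subst_rf (cross_ratio_of q) (cross_ratio_of q') - 1) (transport q (edge q' 3 1))"
    unfolding q'.edge_0_3
    by (simp add: transport_combination edge_q' q'.cross_ratio_of_unit units_in_mem)
  then have "subst_rf (cross_ratio_of q) (cross_ratio_of q') = cross_ratio_of q''"
    by (intro q''.cross_ratio_of_eqI[OF two_rf_neq_zero]) (simp add: edges)
  then have subst: "subst_rf (cross_ratio_of q) (subst_rf (cross_ratio_of q') a) =
      subst_rf (cross_ratio_of q'') a" if "a \<in> Aset" for a
    using alg_endo_A_eqI[OF alg_endo_A_comp[OF subst.alg_endo_A q'.subst.alg_endo_A]
        q''.subst.alg_endo_A _ that] by simp
  note coords = A.coords_mem[OF two_unit_A, unfolded sl2_over_Aset, OF \<open>M \<in> gset\<close>]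
  show ?thesis
    unfolding transport_def[of q'] transport_def[of q''] semilin3_def
    by (simp add: transport_add transport_smat gset_add gset_smat edges edge_q' coords subst)
qed

end

lemma transport_pt:
  assumes "(2::'k::field) \<noteq> 0" "M \<in> (gset :: ('k rf ^ 2 ^ 2) set)"
  shows "transport pt M = M"
proof -
  interpret four_A_points "pt :: nat \<Rightarrow> 'k rf \<times> 'k rf"
    by unfold_locales (rule assms(1))
  show ?thesis
    using trace0_expand[OF two_rf_neq_zero, of M] assms(2)
      A.coords_mem[OF two_unit_A, unfolded sl2_over_Aset]
    by (simp add: gset_def transport_def semilin3_def cross_ratio_of_pt subst_rf_T_ident
        edge_pt_base X_eq_xm Y_eq_ym Z_eq_zm)
qed

section \<open>The action of the symmetric group\<close>

definition rho :: "(nat \<Rightarrow> nat) \<Rightarrow> 'k::field rf ^ 2 ^ 2 \<Rightarrow> 'k rf ^ 2 ^ 2" where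
  "rho \<sigma> = transport (pt \<circ> \<sigma>)"

lemma S4_iff_permutes: "\<sigma> \<in> S4 \<longleftrightarrow> \<sigma> permutes {0..3}"
proof -
  have "{0, 1, 2, 3} = {0..3::nat}"
    by auto
  then show ?thesis
    by (simp add: S4_def)
qed

lemma S4_in_iff: "\<sigma> \<in> S4 \<Longrightarrow> \<sigma> i \<in> {0..3} \<longleftrightarrow> i \<in> {0..3}"
  unfolding S4_iff_permutes by (rule permutes_in_image)

lemma S4_eq_iff: "\<sigma> \<in> S4 \<Longrightarrow> \<sigma> i = \<sigma> j \<longleftrightarrow> i = j"
  unfolding S4_iff_permutes by (rule inj_eq[OF permutes_inj])

lemma S4_comp: "\<sigma> \<in> S4 \<Longrightarrow> \<pi> \<in> S4 \<Longrightarrow> \<sigma> \<circ> \<pi> \<in> S4"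
  and S4_inv: "\<sigma> \<in> S4 \<Longrightarrow> inv \<sigma> \<in> S4"
  unfolding S4_def by (simp_all add: permutes_compose permutes_inv)

lemma S4_inv_comp: "\<sigma> \<in> S4 \<Longrightarrow> inv \<sigma> \<circ> \<sigma> = id" "\<sigma> \<in> S4 \<Longrightarrow> \<sigma> \<circ> inv \<sigma> = id"
  unfolding S4_def by (simp_all add: permutes_inv_o)

lemma transpose_in_S4: "i \<in> {0..3} \<Longrightarrow> j \<in> {0..3} \<Longrightarrow> transpose i j \<in> S4"
  unfolding S4_iff_permutes by (rule permutes_swap_id)

lemma lift_minus: "lift (- M) = - lift M"
  by (simp add: lift_def vec_eq_iff)

lemma cross_ratio_of_pt_c123: "cross_ratio_of (pt \<circ> c123) = t1"
  and cross_ratio_of_pt_transpose: "cross_ratio_of (pt \<circ> transpose 1 2) = 1 - T"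
  by (simp_all add: cross_ratio_of_def cross_ratio_def pt_def wedge_def c123_def
      Transposition.transpose_def t1_def divide_simps)

lemma edge_pt_base_swap: "edge pt 2 1 = - X" "edge pt 3 2 = - Y" "edge pt 1 3 = - Z"
  by (simp_all add: edge_swap[of pt 2 1] edge_swap[of pt 3 2] edge_swap[of pt 1 3] edge_pt_base)

text \<open>The Klein four-group preserves cross-ratios, so it acts \<open>\<A>\<close>-linearly.\<close>
lemma cross_ratio_of_pt_double_transpose:
  "cross_ratio_of (pt \<circ> (transpose 1 2 \<circ> transpose 3 0)) = T"
  "cross_ratio_of (pt \<circ> (transpose 2 3 \<circ> transpose 1 0)) = T"
  by (simp_all add: cross_ratio_of_def cross_ratio_def pt_def wedge_def Transposition.transpose_def)

context
  assumes two: "(2::'k::field) \<noteq> 0"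
begin

lemma four_A_points_pt_comp:
  assumes "\<sigma> \<in> S4"
  shows "four_A_points (pt \<circ> \<sigma> :: nat \<Rightarrow> 'k rf \<times> 'k rf)"
  using pt.four_points_comp assms two
  by (simp add: S4_iff_permutes four_A_points_def four_A_points_axioms_def)

lemmas rho_in_gset = four_A_points.transport_in_gset[OF four_A_points_pt_comp, folded rho_def]
  and rho_add = four_A_points.transport_add[OF four_A_points_pt_comp, folded rho_def]
  and rho_smat = four_A_points.transport_smat[OF four_A_points_pt_comp, folded rho_def]
  and rho_brk = four_A_points.transport_brk[OF four_A_points_pt_comp, folded rho_def]
  and rho_edge = four_A_points.transport_edge
    [OF four_A_points_pt_comp, folded rho_def, unfolded edge_comp]

lemma rho_comp:
  assumes "\<sigma> \<in> S4" "\<pi> \<in> S4" "M \<in> (gset :: ('k rf ^ 2 ^ 2) set)"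
  shows "rho (\<sigma> \<circ> \<pi>) M = rho \<sigma> (rho \<pi> M)"
proof -
  interpret \<sigma>: four_A_points "pt \<circ> \<sigma> :: nat \<Rightarrow> 'k rf \<times> 'k rf"
    by (rule four_A_points_pt_comp[OF assms(1)])
  have "rho \<sigma> (edge (pt \<circ> \<pi>) i j) = (edge (pt \<circ> (\<sigma> \<circ> \<pi>)) i j :: 'k rf ^ 2 ^ 2)"
    if "i \<in> {0..3}" "j \<in> {0..3}" "i \<noteq> j" for i j
    using that assms(1,2)
    by (simp add: edge_comp rho_edge S4_in_iff S4_eq_iff del: atLeastAtMost_iff)
  then show ?thesis
    unfolding rho_def
    by (intro \<sigma>.transport_transport[symmetric] four_A_points_pt_comp S4_comp assms)
qed

lemma rho_id: "M \<in> gset \<Longrightarrow> rho id M = (M :: 'k rf ^ 2 ^ 2)"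
  by (simp add: rho_def transport_pt two)

lemma bij_betw_rho:
  assumes "\<sigma> \<in> S4"
  shows "bij_betw (rho \<sigma>) (gset :: ('k rf ^ 2 ^ 2) set) gset"
proof (rule bij_betw_byWitness[where f' = "rho (inv \<sigma>)"])
  show "\<forall>M\<in>gset. rho (inv \<sigma>) (rho \<sigma> M) = (M :: 'k rf ^ 2 ^ 2)"
    using assms by (simp add: S4_inv S4_inv_comp rho_id flip: rho_comp)
  show "\<forall>M\<in>gset. rho \<sigma> (rho (inv \<sigma>) M) = (M :: 'k rf ^ 2 ^ 2)"
    using assms by (simp add: S4_inv S4_inv_comp rho_id flip: rho_comp)
qed (use assms S4_inv rho_in_gset in blast)+

lemma lie_aut_rho:
  assumes "\<sigma> \<in> S4" "K \<subseteq> Aset" "\<And>a. a \<in> K \<Longrightarrow> subst_rf (cross_ratio_of (pt \<circ> \<sigma>)) a = a"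
  shows "lie_aut K (gset :: ('k rf ^ 2 ^ 2) set) (rho \<sigma>)"
  unfolding lie_aut_def
  using assms by (auto simp: bij_betw_rho rho_add rho_smat rho_brk gset_smat subset_iff)

lemma lie_aut_rho_range_emb: "\<sigma> \<in> S4 \<Longrightarrow> lie_aut (range emb) (gset :: ('k rf ^ 2 ^ 2) set) (rho \<sigma>)"
  by (rule lie_aut_rho) (auto simp: emb_in_Aset)

lemma rho_inj:
  assumes "\<sigma> \<in> S4" "\<pi> \<in> S4" "\<And>M :: 'k rf ^ 2 ^ 2. M \<in> gset \<Longrightarrow> rho \<sigma> M = rho \<pi> M"
  shows "\<sigma> = \<pi>"
proof
  fix i
  show "\<sigma> i = \<pi> i"
  proof (cases "i \<in> {0..3}")
    case True
    define j :: nat where "j = (if i = 0 then 1 else 0)"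
    have j: "j \<in> {0..3}" "i \<noteq> j"
      by (simp_all add: j_def)
    then have same_edge: "(edge pt (\<sigma> i) (\<sigma> j) :: 'k rf ^ 2 ^ 2) = edge pt (\<pi> i) (\<pi> j)"
      using assms(3)[of "edge pt i j"] True by (simp add: rho_edge edge_pt_in_gset assms(1,2))
    have "(2 :: 'k rf) \<noteq> 0"
      using two by (simp flip: emb_numeral)
    then show ?thesis
      using same_edge
      by (rule pt.edge_eq_imp_eq)
        (use True j in \<open>simp_all add: assms(1,2) S4_in_iff S4_eq_iff del: atLeastAtMost_iff\<close>)
  next
    case False
    then show ?thesis
      using assms(1,2) by (simp add: S4_iff_permutes permutes_not_in del: atLeastAtMost_iff)
  qed
qed

lemma rho_eq_tens_phi: "rho c123 = (tens phiS phiA :: 'k rf ^ 2 ^ 2 \<Rightarrow> _)"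
  unfolding rho_def transport_def tens_eq_semilin3 cross_ratio_of_pt_c123
  by (simp add: edge_comp c123_def edge_pt_base phiS_basis[OF two] X_def Y_def Z_def phiA_def)

lemma rho_eq_tens_tau: "rho (transpose 1 2) = (tens tauS tauA :: 'k rf ^ 2 ^ 2 \<Rightarrow> _)"
  unfolding rho_def transport_def tens_eq_semilin3 cross_ratio_of_pt_transpose
  by (simp add: edge_comp Transposition.transpose_def edge_pt_base_swap
      tauS_basis[OF two] X_def Y_def Z_def lift_minus tauA_def)

lemma rho_eq_lin3:
  assumes "cross_ratio_of (pt \<circ> \<sigma>) = (T :: 'k rf)" "M \<in> (gset :: ('k rf ^ 2 ^ 2) set)"
  shows "rho \<sigma> M = lin3 (edge pt (\<sigma> 1) (\<sigma> 2)) (edge pt (\<sigma> 2) (\<sigma> 3)) (edge pt (\<sigma> 3) (\<sigma> 1)) M"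
  using A.coords_mem[OF two_unit[OF two] assms(2)[folded sl2_over_Aset]]
  by (simp add: rho_def transport_def semilin3_def lin3_def edge_comp assms(1) subst_rf_T_ident)

lemma rho_eq_tau1:
  "M \<in> gset \<Longrightarrow> rho (transpose 1 2 \<circ> transpose 3 0) M = (tau1 M :: 'k rf ^ 2 ^ 2)"
  unfolding rho_eq_lin3[OF cross_ratio_of_pt_double_transpose(1)]
  by (simp add: tau1_def Transposition.transpose_def edge_pt_base_swap
      edge_swap[of pt 1 0] edge_pt_0)

lemma rho_eq_tau2:
  "M \<in> gset \<Longrightarrow> rho (transpose 2 3 \<circ> transpose 1 0) M = (tau2 M :: 'k rf ^ 2 ^ 2)"
  unfolding rho_eq_lin3[OF cross_ratio_of_pt_double_transpose(2)]
  by (simp add: tau2_def Transposition.transpose_def edge_pt_base_swap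
      edge_swap[of pt 2 0] edge_pt_0)

lemma lie_aut_Aset_if_eq_rho:
  fixes f :: "'k rf ^ 2 ^ 2 \<Rightarrow> 'k rf ^ 2 ^ 2"
  assumes "\<sigma> \<in> S4" "cross_ratio_of (pt \<circ> \<sigma>) = (T :: 'k rf)" "\<And>M. M \<in> gset \<Longrightarrow> rho \<sigma> M = f M"
  shows "lie_aut Aset gset f"
proof -
  have "lie_aut Aset (gset :: ('k rf ^ 2 ^ 2) set) (rho \<sigma>)"
    by (rule lie_aut_rho[OF assms(1)]) (simp_all add: assms(2) subst_rf_T_ident)
  then show ?thesis
    using bij_betw_cong[of gset "rho \<sigma>" f gset]
    by (simp add: lie_aut_def gset_add gset_smat gset_brk flip: assms(3))
qed

lemma lie_aut_tau1: "lie_aut Aset gset (tau1 :: 'k rf ^ 2 ^ 2 \<Rightarrow> _)"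
  by (rule lie_aut_Aset_if_eq_rho[OF _ cross_ratio_of_pt_double_transpose(1) rho_eq_tau1])
    (simp_all add: S4_comp transpose_in_S4)

lemma lie_aut_tau2: "lie_aut Aset gset (tau2 :: 'k rf ^ 2 ^ 2 \<Rightarrow> _)"
  by (rule lie_aut_Aset_if_eq_rho[OF _ cross_ratio_of_pt_double_transpose(2) rho_eq_tau2])
    (simp_all add: S4_comp transpose_in_S4)

end

section \<open>Equivariance of \<open>\<Psi>\<close>\<close>

definition lie_hom ::
  "('a::comm_ring_1 \<Rightarrow> 'l::ab_group_add \<Rightarrow> 'l) \<Rightarrow> ('l \<Rightarrow> 'l \<Rightarrow> 'l) \<Rightarrow>
    ('a \<Rightarrow> 'm::ab_group_add \<Rightarrow> 'm) \<Rightarrow> ('m \<Rightarrow> 'm \<Rightarrow> 'm) \<Rightarrow> ('l \<Rightarrow> 'm) \<Rightarrow> bool" where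
  "lie_hom sc lb sc' lb' f \<longleftrightarrow> module_hom sc sc' f \<and> (\<forall>u v. f (lb u v) = lb' (f u) (f v))"

lemma lie_hom_eq_on_lie_span:
  assumes f: "lie_hom sc lb sc' lb' f" and g: "lie_hom sc lb sc' lb' g"
    and "\<And>u. u \<in> G \<Longrightarrow> f u = g u" "u \<in> lie_span sc lb G"
  shows "f u = g u"
proof -
  interpret f: module_hom sc sc' f
    using f by (simp add: lie_hom_def)
  interpret g: module_hom sc sc' g
    using g by (simp add: lie_hom_def)
  show ?thesis
    using assms(4)
  proof induction
    case (brk u v)
    then show ?case
      using f g by (simp add: lie_hom_def)
  qed (simp_all add: assms(3) f.add g.add f.scale g.scale)
qed

lemma lie_hom_comp:
  "lie_hom sc lb sc' lb' f \<Longrightarrow> lie_hom sc' lb' sc'' lb'' g \<Longrightarrow> lie_hom sc lb sc'' lb'' (g \<circ> f)"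
  by (auto simp: lie_hom_def intro: module_hom_compose)

lemma module_homI_affine:
  assumes "module sc" "module sc'" and affine: "\<And>a u v. f (sc a u + v) = sc' a (f u) + f v"
  shows "module_hom sc sc' f"
proof -
  interpret sc: module sc by (rule assms(1))
  interpret sc': module sc' by (rule assms(2))
  have add: "f (u + v) = f u + f v" for u v
    using affine[of 1 u v] by simp
  moreover have "f 0 = 0"
    using add[of 0 0] by (metis add_cancel_right_right)
  then have "f (sc a u) = sc' a (f u)" for a u
    using affine[of a u 0] by simp
  ultimately show ?thesis
    by (simp add: module_hom_iff assms(1,2))
qed

lemma lie_algebra_module: "lie_algebra sc lb \<Longrightarrow> module sc"
  by (simp add: lie_algebra_def module_def)

lemma module_smat_emb: "module (\<lambda>a. smat (emb a))"
  by unfold_locales (simp_all add: smat.scale_right_distrib smat.scale_left_distrib)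

lemma lie_hom_act:
  assumes "lie_algebra sc lb" "tetra_action sc lb Xg act" "\<sigma> \<in> S4"
  shows "lie_hom sc lb sc lb (act \<sigma>)"
  unfolding lie_hom_def
  using assms(2,3) by (intro conjI module_homI_affine lie_algebra_module[OF assms(1)])
    (simp_all add: tetra_action_def)

lemma lie_hom_Psi:
  assumes "lie_algebra sc lb" "is_Psi sc lb Xg Psi"
  shows "lie_hom sc lb (\<lambda>a. smat (emb a)) brk Psi"
  unfolding lie_hom_def
  using assms(2) by (intro conjI module_homI_affine lie_algebra_module[OF assms(1)] module_smat_emb)
    (simp_all add: is_Psi_def)

lemma tetra_gen_lie_algebra: "tetra_gen sc lb Xg \<Longrightarrow> lie_algebra sc lb"
  and tetra_gen_lie_span: "tetra_gen sc lb Xg \<Longrightarrow>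
    u \<in> lie_span sc lb {Xg i j | i j. i \<in> {0..3} \<and> j \<in> {0..3} \<and> i \<noteq> j}"
  by (simp_all add: tetra_gen_def)

context
  fixes sc :: "'k::field \<Rightarrow> 'l::ab_group_add \<Rightarrow> 'l" and lb Xg Psi
  assumes tetra: "tetra_gen sc lb Xg" and Psi: "is_Psi sc lb Xg Psi"
begin

lemma Psi_edge:
  assumes "i \<in> {0..3}" "j \<in> {0..3}" "i \<noteq> j"
  shows "Psi (Xg i j) = edge pt i j"
  using assms
proof (rule tetrahedron_edge_cases)
  fix i j :: nat
  assume ij: "i \<in> {0..3}" "j \<in> {0..3}" "i \<noteq> j" "Psi (Xg i j) = edge pt i j"
  interpret Psi: module_hom sc "\<lambda>a. smat (emb a)" Psi
    using lie_hom_Psi[OF tetra_gen_lie_algebra[OF tetra] Psi] by (simp add: lie_hom_def)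
  have "Xg j i = - Xg i j"
    using tetra ij by (simp add: tetra_gen_def eq_neg_iff_add_eq_0)
  then show "Psi (Xg j i) = edge pt j i"
    using ij by (simp add: Psi.neg edge_swap[of pt j i])
qed (use Psi in \<open>simp_all add: is_Psi_def edge_pt_base edge_pt_0\<close>)

lemma Psi_in_gset: "Psi u \<in> gset"
proof -
  have "lie_hom sc lb (\<lambda>a. smat (emb a)) brk Psi"
    by (rule lie_hom_Psi[OF tetra_gen_lie_algebra[OF tetra] Psi])
  then interpret Psi: module_hom sc "\<lambda>a. smat (emb a)" Psi
    by (simp add: lie_hom_def)
  have "Psi (lb u v) = brk (Psi u) (Psi v)" for u v
    using Psi by (simp add: is_Psi_def)
  with tetra_gen_lie_span[OF tetra, of u] show ?thesis
    by induction (auto simp: Psi_edge edge_pt_in_gset Psi.add Psi.scale gset_zero gset_add gset_smat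
        gset_brk emb_in_Aset simp del: atLeastAtMost_iff)
qed

lemma lie_hom_rho_Psi:
  assumes "(2::'k) \<noteq> 0" "\<sigma> \<in> S4"
  shows "lie_hom sc lb (\<lambda>a. smat (emb a)) brk (rho \<sigma> \<circ> Psi)"
  using lie_hom_Psi[OF tetra_gen_lie_algebra[OF tetra] Psi] assms
  by (simp add: lie_hom_def module_hom_iff rho_add rho_smat rho_brk Psi_in_gset emb_in_Aset)

lemma Psi_equivariant:
  assumes "(2::'k) \<noteq> 0" "tetra_action sc lb Xg act" "\<sigma> \<in> S4"
  shows "Psi (act \<sigma> u) = rho \<sigma> (Psi u)"
proof -
  have lie_hom_Psi_act: "lie_hom sc lb (\<lambda>a. smat (emb a)) brk (Psi \<circ> act \<sigma>)"
    using lie_hom_comp lie_hom_act lie_hom_Psi tetra_gen_lie_algebra tetra Psi assms(2,3) by blast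
  have agree: "(Psi \<circ> act \<sigma>) v = (rho \<sigma> \<circ> Psi) v"
    if "v \<in> {Xg i j | i j. i \<in> {0..3} \<and> j \<in> {0..3} \<and> i \<noteq> j}" for v
    using that assms
    by (auto simp: tetra_action_def Psi_edge rho_edge S4_in_iff S4_eq_iff
        simp del: atLeastAtMost_iff)
  show ?thesis
    using lie_hom_eq_on_lie_span[OF lie_hom_Psi_act lie_hom_rho_Psi[OF assms(1,3)] agree
        tetra_gen_lie_span[OF tetra]]
    by simp
qed

end

theorem theorem1p1:
  assumes "CHAR('k::field) \<noteq> 2"
  shows
   "lie_aut (UNIV :: 'k set) sl2 (phiS :: 'k ^ 2 ^ 2 \<Rightarrow> _) \<and> order_on (sl2 :: ('k ^ 2 ^ 2) set) phiS 3 \<and>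
    lie_aut (UNIV :: 'k set) sl2 (tauS :: 'k ^ 2 ^ 2 \<Rightarrow> _) \<and> order_on (sl2 :: ('k ^ 2 ^ 2) set) tauS 2 \<and>
    alg_aut_A (phiA :: 'k rf \<Rightarrow> _) \<and> order_on (Aset :: 'k rf set) phiA 3 \<and>
    alg_aut_A (tauA :: 'k rf \<Rightarrow> _) \<and> order_on (Aset :: 'k rf set) tauA 2 \<and>
    lie_aut Aset gset (tau1 :: 'k rf ^ 2 ^ 2 \<Rightarrow> _) \<and>
    lie_aut Aset gset (tau2 :: 'k rf ^ 2 ^ 2 \<Rightarrow> _) \<and>
    (\<exists>\<rho> :: (nat \<Rightarrow> nat) \<Rightarrow> 'k rf ^ 2 ^ 2 \<Rightarrow> 'k rf ^ 2 ^ 2.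
       (\<forall>\<sigma>\<in>S4. lie_aut (range emb) gset (\<rho> \<sigma>)) \<and>
       (\<forall>\<sigma>\<in>S4. \<forall>\<pi>\<in>S4. \<forall>M\<in>gset. \<rho> (\<sigma> \<circ> \<pi>) M = \<rho> \<sigma> (\<rho> \<pi> M)) \<and>
       (\<forall>\<sigma>\<in>S4. \<forall>\<pi>\<in>S4. \<sigma> \<noteq> \<pi> \<longrightarrow> (\<exists>M\<in>gset. \<rho> \<sigma> M \<noteq> \<rho> \<pi> M)) \<and>
       (\<forall>M\<in>gset. \<rho> c123 M = tens phiS phiA M) \<and>
       (\<forall>M\<in>gset. \<rho> (transpose 1 2) M = tens tauS tauA M) \<and>
       (\<forall>M\<in>gset. \<rho> (transpose 1 2 \<circ> transpose 3 0) M = tau1 M) \<and>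
       (\<forall>M\<in>gset. \<rho> (transpose 2 3 \<circ> transpose 1 0) M = tau2 M) \<and>
       (\<forall>a\<in>Aset. \<forall>M\<in>gset. \<rho> c123 (smat a M) = smat (phiA a) (\<rho> c123 M)) \<and>
       (\<forall>a\<in>Aset. \<forall>M\<in>gset. \<rho> (transpose 1 2) (smat a M) = smat (tauA a) (\<rho> (transpose 1 2) M)) \<and>
       (\<forall>(sc :: 'k \<Rightarrow> 'l::ab_group_add \<Rightarrow> 'l) lb Xg act Psi.
          tetra_gen sc lb Xg \<and> tetra_action sc lb Xg act \<and> is_Psi sc lb Xg Psi \<longrightarrow>
          (\<forall>\<sigma>\<in>S4. \<forall>u. Psi (act \<sigma> u) = \<rho> \<sigma> (Psi u))))"
proof -
  note two = two_neq_zero_of_CHAR[OF assms]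
  show ?thesis
  proof (intro conjI exI[of _ rho] ballI allI impI)
    show "lie_aut (range emb) gset (rho \<sigma> :: 'k rf ^ 2 ^ 2 \<Rightarrow> _)" if "\<sigma> \<in> S4" for \<sigma>
      by (rule lie_aut_rho_range_emb[OF two that])
    show "\<exists>M\<in>gset. rho \<sigma> M \<noteq> (rho \<pi> M :: 'k rf ^ 2 ^ 2)"
      if "\<sigma> \<in> S4" "\<pi> \<in> S4" "\<sigma> \<noteq> \<pi>" for \<sigma> \<pi>
      using rho_inj[OF two that(1,2)] that(3) by blast
    show "Psi (act \<sigma> u) = rho \<sigma> (Psi u)"
      if "tetra_gen sc lb Xg \<and> tetra_action sc lb Xg act \<and> is_Psi sc lb Xg Psi" "\<sigma> \<in> S4"
      for sc :: "'k \<Rightarrow> 'l \<Rightarrow> 'l" and lb Xg act Psi \<sigma> u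
      using that Psi_equivariant two by blast
  qed (simp_all add: two two_unit lie_aut_phiS lie_aut_tauS order_on_phiS order_on_tauS
      alg_aut_phiA alg_aut_tauA order_on_phiA order_on_tauA lie_aut_tau1 lie_aut_tau2
      rho_comp rho_eq_tens_phi rho_eq_tens_tau rho_eq_tau1 rho_eq_tau2
      phiA.tens_smat tauA.tens_smat)
qed

end
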